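(* If $G$ is a connected cubic abelian Cayley graph, then $\gamma_f^\infty(G)\le\gamma(G)=\gamma_{\mathrm m}^\infty(G)$. Furthermore, $\gamma_f^\infty(G)<\gamma(G)$ if and only if $G$ is isomorphic either to $C_{4k+2}\,\Box\,K_2$ or to $\mathrm{Cay}(\mathbb Z_{8k},\{\pm1,4k\})$ for some integer $k\ge 1$.
   Context: All graphs are finite, simple and undirected. An abelian Cayley graph is a graph $\mathrm{Cay}(A,C)$, where $A$ is a finite abelian group and $C\subseteq A\setminus\{0\}$ satisfies $C=-C$, with vertex set $A$ and $x,y$ adjacent if and only if $x-y\in C$. Cubic means $3$-regular. $C_n$ is the cycle on $n$ vertices and $\Box$ denotes the Cartesian product. $\gamma(G)$ is the domination number, the minimum cardinality of a set $X\subseteq V(G)$ with $\bigcup_{u\in X}N[u]=V(G)$. $N(v)$ is the open neighbourhood and $N[v]=N(v)\cup\{v\}$ the closed neighbourhood of $v$. A fractional dominating function of $G=(V,E)$ is a function $w:V\to[0,\infty)$ with $\sum_{x\in N[v]}w(x)\ge 1$ for all $v\in V$; its total weight is $\sum_{x\in V}w(x)$. Fractional eternal domination. Fix $S$. The defender chooses a fractional dominating function $w_1$ of total weight at most $S$. In each round $i\ge 1$ the attacker, who may choose attacks adaptively, attacks a vertex $v_i\in V$, and the defender chooses amounts $m_{xy,i}\ge 0$ for all $x\in V$, $y\in N(x)$, with $\sum_{y\in N(x)}m_{xy,i}\le w_i(x)$, and sets $w_{i+1}(x)=w_i(x)-\sum_{y\in N(x)}m_{xy,i}+\sum_{y\in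 N(x)}m_{yx,i}$. It is required that $w_{i+1}$ be a fractional dominating function and $w_{i+1}(v_i)\ge 1$. If the defender can respond in this way to every infinite sequence of attacks, $G$ can be eternally $S$-fractionally dominated. $\gamma_f^\infty(G)$ is the infimum of all $S$ for which $G$ can be eternally $S$-fractionally dominated. m-eternal domination. The defender chooses $D_1\subseteq V$ (guard positions). In each round $i\ge1$ the attacker attacks a vertex $v_i\notin D_i$, and the defender replaces $D_i$ by a set $D_{i+1}$ with $v_i\in D_{i+1}$, by moving any number of guards, each to an adjacent vertex or staying put (i.e. there is a bijection $\varphi:D_i\to D_{i+1}$ with $\varphi(u)\in N[u]$). $\gamma_{\mathrm m}^\infty(G)$ is the minimum $|D_1|$ for which the defender can respond to every infinite sequence of attacks. *)

theory Defs
  imports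
    Complex_Main
    "HOL-Algebra.Elementary_Groups"
    "Graph_Theory.Graph_Theory"
begin

text \<open>
  Graphs are represented by \<^typ>\<open>'a pair_pre_digraph\<close>: a finite simple undirected graph is one
  satisfying \<^const>\<open>pair_graph\<close>, with each edge represented by its two opposite arcs.
\<close>

definition nbhd :: "'a pair_pre_digraph \<Rightarrow> 'a \<Rightarrow> 'a set" where
  "nbhd G v = {u. (v, u) \<in> parcs G}"

definition closed_nbhd :: "'a pair_pre_digraph \<Rightarrow> 'a \<Rightarrow> 'a set" where
  "closed_nbhd G v = insert v (nbhd G v)"

definition cubic :: "'a pair_pre_digraph \<Rightarrow> bool" where
  "cubic G \<longleftrightarrow> (\<forall>v\<in>pverts G. card (nbhd G v) = 3)"

definition graph_iso :: "'a pair_pre_digraph \<Rightarrow> 'b pair_pre_digraph \<Rightarrow> bool" where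
  "graph_iso G H \<longleftrightarrow> digraph_iso (with_proj G) (with_proj H)"

definition cycle_graph :: "nat \<Rightarrow> nat pair_pre_digraph" where
  "cycle_graph n = \<lparr> pverts = {0..<n},
     parcs = {(x, y). x < n \<and> y < n \<and> (y = Suc x mod n \<or> x = Suc y mod n)} \<rparr>"

definition complete_graph :: "nat \<Rightarrow> nat pair_pre_digraph" where
  "complete_graph n = \<lparr> pverts = {0..<n}, parcs = {(x, y). x < n \<and> y < n \<and> x \<noteq> y} \<rparr>"

definition box_product ::
    "'a pair_pre_digraph \<Rightarrow> 'b pair_pre_digraph \<Rightarrow> ('a \<times> 'b) pair_pre_digraph" where
  "box_product G H = \<lparr> pverts = pverts G \<times> pverts H,
     parcs = {((a, b), (c, d)). a = c \<and> a \<in> pverts G \<and> (b, d) \<in> parcs H \<or>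
                                b = d \<and> b \<in> pverts H \<and> (a, c) \<in> parcs G} \<rparr>"

text \<open>
  Groups are written multiplicatively in HOL-Algebra, so the difference of \<open>x\<close> and \<open>y\<close>
  is \<open>x \<otimes> inv y\<close> and the zero element is \<open>\<one>\<close>.
\<close>

definition cayley_graph :: "'a monoid \<Rightarrow> 'a set \<Rightarrow> 'a pair_pre_digraph" where
  "cayley_graph A C = \<lparr> pverts = carrier A,
     parcs = {(x, y). x \<in> carrier A \<and> y \<in> carrier A \<and> x \<otimes>\<^bsub>A\<^esub> inv\<^bsub>A\<^esub> y \<in> C} \<rparr>"

definition abelian_cayley_graph :: "'a pair_pre_digraph \<Rightarrow> bool" where
  "abelian_cayley_graph G \<longleftrightarrow> (\<exists>(A :: 'a monoid) C.
     comm_group A \<and> finite (carrier A) \<and>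
     C \<subseteq> carrier A - {\<one>\<^bsub>A\<^esub>} \<and> C = m_inv A ` C \<and> G = cayley_graph A C)"

lemma pair_graph_cayley_graph:
  assumes "comm_group A" "finite (carrier A)"
    and C: "C \<subseteq> carrier A - {\<one>\<^bsub>A\<^esub>}" "C = m_inv A ` C"
  shows "pair_graph (cayley_graph A C)"
proof -
  interpret comm_group A by fact
  have sym: "y \<otimes>\<^bsub>A\<^esub> inv\<^bsub>A\<^esub> x \<in> C"
    if "x \<in> carrier A" "y \<in> carrier A" "x \<otimes>\<^bsub>A\<^esub> inv\<^bsub>A\<^esub> y \<in> C" for x y
  proof -
    have "inv\<^bsub>A\<^esub> (x \<otimes>\<^bsub>A\<^esub> inv\<^bsub>A\<^esub> y) \<in> C" using that C(2) by blast
    then show ?thesis using that by (simp add: inv_mult_group)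
  qed
  have "parcs (cayley_graph A C) \<subseteq> carrier A \<times> carrier A"
    by (auto simp: cayley_graph_def)
  then have fin: "finite (parcs (cayley_graph A C))"
    using assms(2) by (meson finite_SigmaI finite_subset)
  show ?thesis
  proof (unfold_locales, goal_cases)
    case 4
    then show ?case using fin by (simp add: cayley_graph_def)
  qed (use assms(2) C(1) sym fin in \<open>auto simp: cayley_graph_def symmetric_def intro!: symI\<close>)
qed

text \<open>\<open>mobius_cayley k\<close> is the graph \<open>Cay(\<int>\<^sub>8\<^sub>k, {\<plusminus>1, 4k})\<close>; here
  \<^const>\<open>integer_mod_group\<close> is \<open>\<int>\<^sub>n\<close> with carrier \<open>{0..<n}\<close>.\<close>

definition mobius_cayley :: "nat \<Rightarrow> int pair_pre_digraph" where
  "mobius_cayley k = cayley_graph (integer_mod_group (8 * k))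
     {1, inv\<^bsub>integer_mod_group (8 * k)\<^esub> 1, int (4 * k)}"

definition dominating_set :: "'a pair_pre_digraph \<Rightarrow> 'a set \<Rightarrow> bool" where
  "dominating_set G X \<longleftrightarrow> X \<subseteq> pverts G \<and> (\<Union>u\<in>X. closed_nbhd G u) = pverts G"

definition domination_number :: "'a pair_pre_digraph \<Rightarrow> nat" where
  "domination_number G = (LEAST n. \<exists>X. dominating_set G X \<and> card X = n)"

definition fractional_dominating :: "'a pair_pre_digraph \<Rightarrow> ('a \<Rightarrow> real) \<Rightarrow> bool" where
  "fractional_dominating G w \<longleftrightarrow>
     (\<forall>v\<in>pverts G. 0 \<le> w v) \<and> (\<forall>v\<in>pverts G. (\<Sum>x\<in>closed_nbhd G v. w x) \<ge> 1)"

text \<open>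
  In both games a strategy of the defender is a function \<open>\<sigma>\<close> from the finite list of the attacks
  made so far (oldest first) to the current position; \<open>\<sigma> []\<close> is the initial position.
  Against the attack sequence \<open>a\<close>, indexed from 0, the position before the attack \<open>a i\<close> is
  \<open>\<sigma> (map a [0..<i])\<close>. Since a strategy sees only past attacks and has to work against
  every sequence, this covers adaptive attackers.
\<close>

definition fractional_response ::
    "'a pair_pre_digraph \<Rightarrow> ('a \<Rightarrow> real) \<Rightarrow> 'a \<Rightarrow> ('a \<Rightarrow> real) \<Rightarrow> bool" where
  "fractional_response G w v w' \<longleftrightarrow>
     (\<exists>m :: 'a \<Rightarrow> 'a \<Rightarrow> real.
        (\<forall>x\<in>pverts G. \<forall>y\<in>nbhd G x. 0 \<le> m x y) \<and>
        (\<forall>x\<in>pverts G. (\<Sum>y\<in>nbhd G x. m x y) \<le> w x) \<and>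
        (\<forall>x\<in>pverts G. w' x = w x - (\<Sum>y\<in>nbhd G x. m x y) + (\<Sum>y\<in>nbhd G x. m y x))) \<and>
     fractional_dominating G w' \<and> w' v \<ge> 1"

definition eternally_fractionally_dominated :: "'a pair_pre_digraph \<Rightarrow> real \<Rightarrow> bool" where
  "eternally_fractionally_dominated G S \<longleftrightarrow>
     (\<exists>\<sigma> :: 'a list \<Rightarrow> 'a \<Rightarrow> real.
        fractional_dominating G (\<sigma> []) \<and> (\<Sum>x\<in>pverts G. \<sigma> [] x) \<le> S \<and>
        (\<forall>a :: nat \<Rightarrow> 'a. (\<forall>i. a i \<in> pverts G) \<longrightarrow>
           (\<forall>i. fractional_response G (\<sigma> (map a [0..<i])) (a i) (\<sigma> (map a [0..<Suc i])))))"

definition fractional_eternal_domination_number :: "'a pair_pre_digraph \<Rightarrow> real" where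
  "fractional_eternal_domination_number G = Inf {S. eternally_fractionally_dominated G S}"

definition guard_response ::
    "'a pair_pre_digraph \<Rightarrow> 'a set \<Rightarrow> 'a \<Rightarrow> 'a set \<Rightarrow> bool" where
  "guard_response G D v D' \<longleftrightarrow>
     v \<in> D' \<and> (\<exists>\<phi>. bij_betw \<phi> D D' \<and> (\<forall>u\<in>D. \<phi> u \<in> closed_nbhd G u))"

text \<open>
  Only unoccupied vertices may be attacked, so the defender has to answer the attack \<open>a i\<close> provided
  that it and all earlier attacks were legal. If all vertices are occupied, no attack is possible and
  the defender survives.
\<close>

definition m_eternally_dominated :: "'a pair_pre_digraph \<Rightarrow> nat \<Rightarrow> bool" where
  "m_eternally_dominated G n \<longleftrightarrow>
     (\<exists>\<sigma> :: 'a list \<Rightarrow> 'a set.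
        \<sigma> [] \<subseteq> pverts G \<and> card (\<sigma> []) = n \<and>
        (\<forall>(a :: nat \<Rightarrow> 'a) i. (\<forall>j\<le>i. a j \<in> pverts G - \<sigma> (map a [0..<j])) \<longrightarrow>
           guard_response G (\<sigma> (map a [0..<i])) (a i) (\<sigma> (map a [0..<Suc i]))))"

definition m_eternal_domination_number :: "'a pair_pre_digraph \<Rightarrow> nat" where
  "m_eternal_domination_number G = (LEAST n. m_eternally_dominated G n)"

end

theory Submission
  imports Defs "HOL-Library.Multiset" "HOL-Library.Indicator_Function"
begin

text \<open>
  Two things come from translations alone. If \<open>D\<close> dominates an abelian Cayley graph and an
  attacked vertex \<open>v\<close> is dominated by \<open>u \<in> D\<close>, then translating all of \<open>D\<close> by \<open>v - u\<close> moves every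
  guard along an edge (or not at all), reaches \<open>v\<close>, and yields another dominating set. Hence the
  m-eternal domination number is the domination number \<open>\<gamma>\<close>, and indicator functions show that the
  fractional number is at most \<open>\<gamma>\<close>
  (\<open>cayley_m_eternal_eq_domination\<close>, \<open>cayley_fractional_le_domination\<close>).

  The strict inequality needs the structure of the graph. A connection set of three elements
  contains an involution \<open>b\<close>, and its other two elements \<open>a\<close>, \<open>c\<close> are inverse to each other or both
  involutions. Stepping alternately by \<open>a\<close> and \<open>c\<inverse>\<close> wraps the infinite ladder with rungs \<open>b\<close> around
  the graph; so the graph is a closed ladder with some number \<open>n\<close> of rungs, closed up either
  directly (a prism) or with the two sides interchanged (a Moebius ladder)
  (\<open>cubic_abelian_cayley_ladder\<close>). Everything else depends only on \<open>n\<close> and on this twist.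

  If a vertex carries weight 1, then the closed neighbourhoods of suitable vertices in every second
  column are disjoint and avoid it, so a fractional dominating function has weight at least
  \<open>\<lceil>n/2\<rceil>\<close> (\<open>ladder_weight_ge\<close>). The vertices in every second column, on alternating sides,
  form a dominating set of that size, unless \<open>n\<close> is even and the alternation does not match up where
  the ladder closes; this bad case is called \<open>frustrated\<close> below. Outside it, all three numbers
  are therefore equal to \<open>\<lceil>n/2\<rceil>\<close>.

  In the frustrated case a dominating set of size \<open>n/2\<close> would be a perfect code, a perfect code is
  forced to alternate, and so \<open>\<gamma> \<ge> n/2 + 1\<close> (\<open>domination_number_gt_if_frustrated\<close>). A fractional
  defender does better: weight \<open>1/4\<close> everywhere is dominating by itself, and an extra \<open>3/4\<close> can sit on
  the last attacked vertex. Since any two vertices are joined by three internally disjoint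
  paths, and each inner vertex can pass on its own \<open>1/4\<close>, the extra weight gets from any vertex to
  any other in a single round (\<open>focus_response\<close>). This costs only \<open>n/2 + 3/4 < n/2 + 1\<close>. Finally, the
  frustrated closed ladders are the prisms over cycles of length \<open>4k + 2\<close> and the Moebius
  ladders on \<open>8k\<close> vertices.
\<close>


section \<open>Neighbourhoods in symmetric graphs\<close>

lemma nbhd_subset: "pair_graph G \<Longrightarrow> nbhd G v \<subseteq> pverts G"
  by (auto simp: nbhd_def dest: pair_wf_digraph.in_arcsD2[OF pair_digraph.axioms(1)[THEN pair_fin_digraph.axioms(1)]]
      pair_graph.axioms)

lemma finite_pverts: "pair_graph G \<Longrightarrow> finite (pverts G)"
  by (meson pair_digraph.axioms(1) pair_fin_digraph.pair_finite_verts pair_graph.axioms(1))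

lemma finite_nbhd: "pair_graph G \<Longrightarrow> finite (nbhd G v)"
  using nbhd_subset finite_pverts finite_subset by metis

lemma nbhd_sym: "pair_graph G \<Longrightarrow> u \<in> nbhd G v \<longleftrightarrow> v \<in> nbhd G u"
proof -
  assume "pair_graph G"
  then interpret pair_graph G .
  show ?thesis using arcs_symmetric by (auto simp: nbhd_def)
qed

lemma nbhd_irrefl: "pair_graph G \<Longrightarrow> v \<notin> nbhd G v"
proof -
  assume "pair_graph G"
  then interpret pair_graph G .
  show ?thesis using no_loops' by (auto simp: nbhd_def)
qed

lemma closed_nbhd_sym: "pair_graph G \<Longrightarrow> u \<in> closed_nbhd G v \<longleftrightarrow> v \<in> closed_nbhd G u"
  by (auto simp: closed_nbhd_def nbhd_sym)

lemma closed_nbhd_subset: "pair_graph G \<Longrightarrow> v \<in> pverts G \<Longrightarrow> closed_nbhd G v \<subseteq> pverts G"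
  using nbhd_subset by (fastforce simp: closed_nbhd_def)

lemma finite_closed_nbhd: "pair_graph G \<Longrightarrow> finite (closed_nbhd G v)"
  using finite_nbhd by (simp add: closed_nbhd_def)


section \<open>Strategies and invariant families of positions\<close>

text \<open>
  Both sides add up the transport over all arcs; the arcs come in opposite pairs.
\<close>

lemma sum_flow_swap:
  fixes m :: "'a \<Rightarrow> 'a \<Rightarrow> real"
  assumes G: "pair_graph G"
  shows "(\<Sum>x\<in>pverts G. \<Sum>y\<in>nbhd G x. m y x) = (\<Sum>x\<in>pverts G. \<Sum>y\<in>nbhd G x. m x y)"
proof -
  have ext: "(\<Sum>y\<in>nbhd G x. f y) = (\<Sum>y\<in>pverts G. if y \<in> nbhd G x then f y else 0)"
    for x and f :: "'a \<Rightarrow> real"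
    using nbhd_subset[OF G] finite_pverts[OF G]
    by (simp add: sum.inter_restrict[symmetric] Int_absorb1)
  have "(\<Sum>x\<in>pverts G. \<Sum>y\<in>nbhd G x. m y x)
      = (\<Sum>x\<in>pverts G. \<Sum>y\<in>pverts G. if y \<in> nbhd G x then m y x else 0)"
    by (simp only: ext)
  also have "\<dots> = (\<Sum>y\<in>pverts G. \<Sum>x\<in>pverts G. if y \<in> nbhd G x then m y x else 0)"
    by (rule sum.swap)
  also have "\<dots> = (\<Sum>y\<in>pverts G. \<Sum>x\<in>nbhd G y. m y x)"
    by (simp only: ext nbhd_sym[OF G])
  finally show ?thesis .
qed

lemma fractional_response_total:
  assumes G: "pair_graph G" and r: "fractional_response G w v w'"
  shows "sum w' (pverts G) = sum w (pverts G)"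
proof -
  obtain m :: "'a \<Rightarrow> 'a \<Rightarrow> real" where
    "\<forall>x\<in>pverts G. w' x = w x - (\<Sum>y\<in>nbhd G x. m x y) + (\<Sum>y\<in>nbhd G x. m y x)"
    using r unfolding fractional_response_def by blast
  then have "sum w' (pverts G)
      = (\<Sum>x\<in>pverts G. w x - (\<Sum>y\<in>nbhd G x. m x y) + (\<Sum>y\<in>nbhd G x. m y x))"
    by simp
  also have "\<dots> = sum w (pverts G)"
    by (simp add: sum.distrib sum_subtractf sum_flow_swap[OF G, of m])
  finally show ?thesis .
qed

text \<open>
  One attack on \<open>v\<close> suffices: rounds preserve the total weight and leave weight 1
  on \<open>v\<close>. So lower bounds for dominating functions with weight 1 at one vertex are
  lower bounds for the game.
\<close>

lemma eternal_fractional_weight: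
  assumes G: "pair_graph G" and e: "eternally_fractionally_dominated G S" and v: "v \<in> pverts G"
  obtains w where "fractional_dominating G w" "w v \<ge> 1" "sum w (pverts G) \<le> S"
proof -
  obtain \<sigma> :: "'a list \<Rightarrow> 'a \<Rightarrow> real" where S: "(\<Sum>x\<in>pverts G. \<sigma> [] x) \<le> S"
    and r: "\<forall>a :: nat \<Rightarrow> 'a. (\<forall>i. a i \<in> pverts G) \<longrightarrow>
           (\<forall>i. fractional_response G (\<sigma> (map a [0..<i])) (a i) (\<sigma> (map a [0..<Suc i])))"
    using e unfolding eternally_fractionally_dominated_def by blast
  have "fractional_response G (\<sigma> []) v (\<sigma> [v])"
    using r[rule_format, of "\<lambda>_. v" 0] v by simp
  then show ?thesis
    using that[of "\<sigma> [v]"] S fractional_response_total[OF G, of "\<sigma> []" v "\<sigma> [v]"]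
    by (auto simp: fractional_response_def)
qed

text \<open>
  A family of positions in which every attack can be answered without leaving the family gives a
  memoryless strategy: fold a choice of answers over the list of attacks.
\<close>

lemma eternally_fractionally_dominatedI:
  assumes w0: "w0 \<in> W" "sum w0 (pverts G) \<le> S"
    and dom: "\<And>w. w \<in> W \<Longrightarrow> fractional_dominating G w"
    and resp: "\<And>w v. w \<in> W \<Longrightarrow> v \<in> pverts G \<Longrightarrow> \<exists>w'\<in>W. fractional_response G w v w'"
  shows "eternally_fractionally_dominated G S"
proof -
  obtain next_w where next_w: "\<And>w v. w \<in> W \<Longrightarrow> v \<in> pverts G \<Longrightarrow>
      next_w w v \<in> W \<and> fractional_response G w v (next_w w v)"
    using resp by metis
  define \<sigma> where "\<sigma> xs = foldl next_w w0 xs" for xs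
  have "\<sigma> (map a [0..<i]) \<in> W" if "\<forall>i. a i \<in> pverts G" for a i
    using that w0 next_w by (induction i) (auto simp: \<sigma>_def)
  then have "fractional_response G (\<sigma> (map a [0..<i])) (a i) (\<sigma> (map a [0..<Suc i]))"
    if "\<forall>i. a i \<in> pverts G" for a i
    using next_w that by (simp add: \<sigma>_def)
  then show ?thesis
    unfolding eternally_fractionally_dominated_def
    using w0 dom by (intro exI[of _ \<sigma>]) (auto simp: \<sigma>_def)
qed

lemma m_eternally_dominatedI:
  assumes D0: "D0 \<in> \<D>" "card D0 = n"
    and sub: "\<And>D. D \<in> \<D> \<Longrightarrow> D \<subseteq> pverts G"
    and resp: "\<And>D v. D \<in> \<D> \<Longrightarrow> v \<in> pverts G - D \<Longrightarrow> \<exists>D'\<in>\<D>. guard_response G D v D'"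
  shows "m_eternally_dominated G n"
proof -
  obtain next_D where next_D: "\<And>D v. D \<in> \<D> \<Longrightarrow> v \<in> pverts G - D \<Longrightarrow>
      next_D D v \<in> \<D> \<and> guard_response G D v (next_D D v)"
    using resp by metis
  define \<sigma> where "\<sigma> xs = foldl next_D D0 xs" for xs
  have step: "\<sigma> (map a [0..<Suc i]) = next_D (\<sigma> (map a [0..<i])) (a i)" for a i
    by (simp add: \<sigma>_def)
  have inv: "\<sigma> (map a [0..<i]) \<in> \<D>" if "\<forall>j<i. a j \<in> pverts G - \<sigma> (map a [0..<j])" for a i
    using that
  proof (induction i)
    case 0
    then show ?case using D0 by (simp add: \<sigma>_def)
  next
    case (Suc i)
    then have "\<sigma> (map a [0..<i]) \<in> \<D>" "a i \<in> pverts G - \<sigma> (map a [0..<i])" by auto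
    then show ?case using next_D unfolding step by blast
  qed
  have "guard_response G (\<sigma> (map a [0..<i])) (a i) (\<sigma> (map a [0..<Suc i]))"
    if "\<forall>j\<le>i. a j \<in> pverts G - \<sigma> (map a [0..<j])" for a i
    using that inv[of i a] next_D unfolding step by auto
  then show ?thesis
    unfolding m_eternally_dominated_def
    using D0 sub by (intro exI[of _ \<sigma>]) (auto simp: \<sigma>_def)
qed


section \<open>Dominating sets and guard moves\<close>

lemma domination_number_le: "dominating_set G X \<Longrightarrow> domination_number G \<le> card X"
  unfolding domination_number_def by (rule Least_le) blast

lemma dominating_setI:
  assumes "pair_graph G" "X \<subseteq> pverts G" "\<And>v. v \<in> pverts G \<Longrightarrow> \<exists>u\<in>X. v \<in> closed_nbhd G u"
  shows "dominating_set G X"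
  unfolding dominating_set_def using assms closed_nbhd_subset[OF assms(1)] by blast

lemma domination_number_attained:
  assumes G: "pair_graph G"
  obtains X where "dominating_set G X" "card X = domination_number G"
proof -
  have "dominating_set G (pverts G)"
    by (rule dominating_setI[OF G]) (auto simp: closed_nbhd_def)
  then have "\<exists>X. dominating_set G X \<and> card X = domination_number G"
    unfolding domination_number_def by (intro LeastI_ex[where P = "\<lambda>n. \<exists>X. dominating_set G X \<and> card X = n"]) blast
  then show ?thesis using that by blast
qed

text \<open>
  An undominated vertex could not be reached by any guard in the first round.
\<close>

lemma domination_number_le_m_eternal:
  assumes G: "pair_graph G" and e: "m_eternally_dominated G n"
  shows "domination_number G \<le> n"
proof -
  obtain \<sigma> :: "'a list \<Rightarrow> 'a set" where \<sigma>: "\<sigma> [] \<subseteq> pverts G" "card (\<sigma> []) = n"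
    and r: "\<forall>(a :: nat \<Rightarrow> 'a) i. (\<forall>j\<le>i. a j \<in> pverts G - \<sigma> (map a [0..<j])) \<longrightarrow>
           guard_response G (\<sigma> (map a [0..<i])) (a i) (\<sigma> (map a [0..<Suc i]))"
    using e unfolding m_eternally_dominated_def by blast
  have "\<exists>u\<in>\<sigma> []. v \<in> closed_nbhd G u" if v: "v \<in> pverts G" for v
  proof (cases "v \<in> \<sigma> []")
    case True
    then show ?thesis by (auto simp: closed_nbhd_def)
  next
    case False
    then have "guard_response G (\<sigma> []) v (\<sigma> [v])"
      using r[rule_format, of 0 "\<lambda>_. v"] v by simp
    then show ?thesis unfolding guard_response_def bij_betw_def by (metis imageE)
  qed
  then have "dominating_set G (\<sigma> [])" using dominating_setI[OF G] \<sigma> by blast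
  then show ?thesis using domination_number_le \<sigma> by blast
qed


section \<open>Realising redistributions by multisets of arcs\<close>

lemma sum_count_out_arcs:
  assumes G: "pair_graph G" and "set_mset M \<subseteq> parcs G"
  shows "(\<Sum>y\<in>nbhd G x. real (count M (x, y))) = count (image_mset fst M) x"
  using assms(2)
proof (induction M)
  case empty
  then show ?case by simp
next
  case (add e M)
  obtain a b where e: "e = (a, b)" by (cases e)
  have "b \<in> nbhd G a" using add.prems e by (simp add: nbhd_def)
  then have "(\<Sum>y\<in>nbhd G x. if e = (x, y) then 1 else 0 :: real) = (if x = a then 1 else 0)"
    using finite_nbhd[OF G, of x] by (cases "x = a") (auto simp: e)
  moreover have "(\<Sum>y\<in>nbhd G x. real (count (add_mset e M) (x, y)))
      = (\<Sum>y\<in>nbhd G x. real (count M (x, y)) + (if e = (x, y) then 1 else 0))"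
    by (intro sum.cong) auto
  ultimately show ?case using add by (simp add: sum.distrib e)
qed

lemma sum_count_in_arcs:
  assumes G: "pair_graph G" and "set_mset M \<subseteq> parcs G"
  shows "(\<Sum>y\<in>nbhd G x. real (count M (y, x))) = count (image_mset snd M) x"
  using assms(2)
proof (induction M)
  case empty
  then show ?case by simp
next
  case (add e M)
  obtain a b where e: "e = (a, b)" by (cases e)
  have "a \<in> nbhd G b" using add.prems e by (simp add: nbhd_sym[OF G, of a b]) (simp add: nbhd_def)
  then have "(\<Sum>y\<in>nbhd G x. if e = (y, x) then 1 else 0 :: real) = (if x = b then 1 else 0)"
    using finite_nbhd[OF G, of x] by (cases "x = b") (auto simp: e)
  moreover have "(\<Sum>y\<in>nbhd G x. real (count (add_mset e M) (y, x)))
      = (\<Sum>y\<in>nbhd G x. real (count M (y, x)) + (if e = (y, x) then 1 else 0))"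
    by (intro sum.cong) auto
  ultimately show ?case using add by (simp add: sum.distrib e)
qed

text \<open>
  Moving weight \<open>c\<close> along every arc of a multiset \<open>M\<close> is a legal
  answer as soon as no vertex sends out more than it has. This replaces sums over neighbourhoods
  by equations between multisets of tails and heads, which can be checked path by path.
\<close>

lemma fractional_response_arcs:
  fixes c :: real
  assumes G: "pair_graph G" and M: "set_mset M \<subseteq> parcs G" and c: "c \<ge> 0"
    and out: "\<And>x. x \<in> pverts G \<Longrightarrow> c * count (image_mset fst M) x \<le> w x"
    and bal: "\<And>x. x \<in> pverts G \<Longrightarrow>
      w' x = w x - c * count (image_mset fst M) x + c * count (image_mset snd M) x"
    and w': "fractional_dominating G w'" "w' v \<ge> 1"
  shows "fractional_response G w v w'"
  unfolding fractional_response_def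
proof (intro conjI exI[of _ "\<lambda>x y. c * real (count M (x, y))"] w')
qed (use c out bal in \<open>simp_all add: sum_distrib_left[symmetric]
      sum_count_out_arcs[OF G M] sum_count_in_arcs[OF G M]\<close>)

lemma fractional_dominating_indicator:
  assumes G: "pair_graph G" and D: "dominating_set G D"
  shows "fractional_dominating G (indicator D)"
  unfolding fractional_dominating_def
proof (intro conjI ballI)
  fix v assume "v \<in> pverts G"
  then obtain u where u: "u \<in> D" "v \<in> closed_nbhd G u" using D by (auto simp: dominating_set_def)
  then have "indicator D u \<le> (\<Sum>x\<in>closed_nbhd G v. indicator D x :: real)"
    using closed_nbhd_sym[OF G] finite_closed_nbhd[OF G] by (intro member_le_sum) auto
  then show "1 \<le> (\<Sum>x\<in>closed_nbhd G v. indicator D x :: real)" using u by simp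
qed simp

text \<open>
  Guards are unit weights: use as arcs the moves of the guards that leave their vertex.
\<close>

lemma fractional_response_guards:
  assumes G: "pair_graph G" and D: "D \<subseteq> pverts G" and D': "dominating_set G D'"
    and r: "guard_response G D v D'"
  shows "fractional_response G (indicator D) v (indicator D')"
proof -
  obtain \<phi> where \<phi>: "bij_betw \<phi> D D'" "\<forall>u\<in>D. \<phi> u \<in> closed_nbhd G u" and v: "v \<in> D'"
    using r unfolding guard_response_def by blast
  define X where "X = {u \<in> D. \<phi> u \<noteq> u}"
  define M where "M = image_mset (\<lambda>u. (u, \<phi> u)) (mset_set X)"
  have fin: "finite D" "finite X"
    using finite_subset[OF D finite_pverts[OF G]] unfolding X_def by auto
  have inj: "inj_on \<phi> X" using \<phi>(1) by (auto simp: bij_betw_def X_def inj_on_def)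
  have fst: "image_mset fst M = mset_set X" by (simp add: M_def multiset.map_comp comp_def)
  have "image_mset snd M = image_mset \<phi> (mset_set X)"
    by (simp add: M_def multiset.map_comp comp_def)
  then have snd: "image_mset snd M = mset_set (\<phi> ` X)"
    by (simp add: image_mset_mset_set[OF inj])
  have balance: "indicator D' x = (indicator D x - indicator X x + indicator (\<phi> ` X) x :: real)" for x
  proof -
    \<comment> \<open>The guards outside \<open>X\<close> stay, so only \<open>X\<close> is exchanged for its image.\<close>
    have "(\<lambda>u. \<phi> u) ` (D - X) = D - X" by (force simp: X_def)
    moreover have sub: "X \<subseteq> D" by (auto simp: X_def)
    moreover have "D' = \<phi> ` (D - X) \<union> \<phi> ` X"
      using \<phi>(1) sub by (simp add: bij_betw_def Un_absorb2 flip: image_Un)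
    moreover have "\<phi> ` (D - X) \<inter> \<phi> ` X = {}"
      using \<phi>(1) unfolding X_def bij_betw_def inj_on_def by auto
    ultimately have "D' = (D - X) \<union> \<phi> ` X" "X \<subseteq> D" "(D - X) \<inter> \<phi> ` X = {}" by auto
    then show ?thesis by (auto simp: indicator_def)
  qed
  have cnt: "real (count (mset_set Y) x) = indicator Y x" if "finite Y" for Y :: "'a set" and x
    using that by (simp add: count_mset_set' indicator_def)
  show ?thesis
  proof (rule fractional_response_arcs[OF G, of M 1])
    show "set_mset M \<subseteq> parcs G"
      using \<phi>(2) fin by (auto simp: M_def X_def closed_nbhd_def nbhd_def)
  qed (use fin v balance fractional_dominating_indicator[OF G D'] in
      \<open>auto simp: fst snd cnt X_def indicator_def\<close>)
qed


section \<open>Translations of Cayley graphs\<close>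

lemma cayley_closed_nbhd:
  assumes "x \<in> carrier A"
  shows "y \<in> closed_nbhd (cayley_graph A C) x \<longleftrightarrow> y \<in> carrier A \<and> (y = x \<or> x \<otimes>\<^bsub>A\<^esub> inv\<^bsub>A\<^esub> y \<in> C)"
  using assms by (auto simp: closed_nbhd_def nbhd_def cayley_graph_def)

text \<open>
  The new position is the translate of \<open>D\<close> by \<open>g = v - u\<close>, where
  \<open>u \<in> D\<close> dominates \<open>v\<close>. As \<open>g\<close> is zero or lies in
  the connection set, each guard moves along at most one edge; commutativity makes the translate
  dominating.
\<close>

lemma cayley_translate_response:
  assumes A: "comm_group A" "finite (carrier A)"
    and C: "C \<subseteq> carrier A - {\<one>\<^bsub>A\<^esub>}" "C = m_inv A ` C"
    and D: "dominating_set (cayley_graph A C) D" and v: "v \<in> carrier A"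
  obtains D' where "dominating_set (cayley_graph A C) D'" "card D' = card D"
    "guard_response (cayley_graph A C) D v D'"
proof -
  interpret comm_group A by fact
  note G = pair_graph_cayley_graph[OF A C]
  have DA: "D \<subseteq> carrier A" using D by (simp add: dominating_set_def cayley_graph_def)
  have dom: "\<exists>u\<in>D. y \<in> closed_nbhd (cayley_graph A C) u" if "y \<in> carrier A" for y
    using D that by (auto simp: dominating_set_def cayley_graph_def)
  obtain u where u: "u \<in> D" "v = u \<or> u \<otimes>\<^bsub>A\<^esub> inv\<^bsub>A\<^esub> v \<in> C"
    using dom[OF v] DA by (auto simp: cayley_closed_nbhd)
  define g where "g = v \<otimes>\<^bsub>A\<^esub> inv\<^bsub>A\<^esub> u"
  have uA: "u \<in> carrier A" using u DA by blast
  have g: "g \<in> carrier A" using v uA by (simp add: g_def)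
  have ginv: "inv\<^bsub>A\<^esub> g = u \<otimes>\<^bsub>A\<^esub> inv\<^bsub>A\<^esub> v"
    using v uA by (simp add: g_def inv_mult_group)
  have inj: "inj_on (\<lambda>x. g \<otimes>\<^bsub>A\<^esub> x) D"
    using DA g by (auto simp: inj_on_def subset_iff)
  let ?D' = "(\<lambda>x. g \<otimes>\<^bsub>A\<^esub> x) ` D"
  have "dominating_set (cayley_graph A C) ?D'"
  proof (rule dominating_setI[OF G])
    show "?D' \<subseteq> pverts (cayley_graph A C)" using DA g by (auto simp: cayley_graph_def)
    fix y assume "y \<in> pverts (cayley_graph A C)"
    then have y: "y \<in> carrier A" by (simp add: cayley_graph_def)
    then obtain x where x: "x \<in> D" "inv\<^bsub>A\<^esub> g \<otimes>\<^bsub>A\<^esub> y \<in> closed_nbhd (cayley_graph A C) x"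
      using dom[of "inv\<^bsub>A\<^esub> g \<otimes>\<^bsub>A\<^esub> y"] g by auto
    have xA: "x \<in> carrier A" using x DA by blast
    have "x \<otimes>\<^bsub>A\<^esub> inv\<^bsub>A\<^esub> (inv\<^bsub>A\<^esub> g \<otimes>\<^bsub>A\<^esub> y) = (g \<otimes>\<^bsub>A\<^esub> x) \<otimes>\<^bsub>A\<^esub> inv\<^bsub>A\<^esub> y"
    proof -
      have "inv\<^bsub>A\<^esub> (inv\<^bsub>A\<^esub> g \<otimes>\<^bsub>A\<^esub> y) = g \<otimes>\<^bsub>A\<^esub> inv\<^bsub>A\<^esub> y"
        using inv_mult[of "inv\<^bsub>A\<^esub> g" y] y g by simp
      then show ?thesis using m_assoc[of x g "inv\<^bsub>A\<^esub> y"] m_comm[of x g] xA y g by simp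
    qed
    moreover have "y = g \<otimes>\<^bsub>A\<^esub> x" if "inv\<^bsub>A\<^esub> g \<otimes>\<^bsub>A\<^esub> y = x"
      unfolding that[symmetric] using y g by (simp flip: m_assoc)
    ultimately have "y \<in> closed_nbhd (cayley_graph A C) (g \<otimes>\<^bsub>A\<^esub> x)"
      using x xA y g by (auto simp: cayley_closed_nbhd)
    then show "\<exists>u\<in>?D'. y \<in> closed_nbhd (cayley_graph A C) u" using x by blast
  qed
  moreover have "guard_response (cayley_graph A C) D v ?D'"
    unfolding guard_response_def
  proof (intro conjI exI[of _ "\<lambda>x. g \<otimes>\<^bsub>A\<^esub> x"] ballI)
    have "g \<otimes>\<^bsub>A\<^esub> u = v" using v uA by (simp add: g_def m_assoc)
    then show "v \<in> ?D'" using u by blast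
    show "bij_betw (\<lambda>x. g \<otimes>\<^bsub>A\<^esub> x) D ?D'" using inj by (simp add: bij_betw_def)
    fix x assume "x \<in> D"
    then have x: "x \<in> carrier A" using DA by blast
    have "x \<otimes>\<^bsub>A\<^esub> inv\<^bsub>A\<^esub> (g \<otimes>\<^bsub>A\<^esub> x) = inv\<^bsub>A\<^esub> g"
      using x g m_assoc[of x "inv\<^bsub>A\<^esub> x" "inv\<^bsub>A\<^esub> g"] by (simp add: inv_mult_group)
    moreover have "g = \<one>\<^bsub>A\<^esub> \<or> inv\<^bsub>A\<^esub> g \<in> C" using u(2) uA unfolding ginv by (auto simp: g_def)
    ultimately show "g \<otimes>\<^bsub>A\<^esub> x \<in> closed_nbhd (cayley_graph A C) x"
      using x g by (auto simp: cayley_closed_nbhd)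
  qed
  ultimately show ?thesis using that card_image[OF inj] by blast
qed

lemma abelian_cayley_pair_graph: "abelian_cayley_graph G \<Longrightarrow> pair_graph G"
  unfolding abelian_cayley_graph_def using pair_graph_cayley_graph by blast

lemma cayley_dominating_response:
  assumes "abelian_cayley_graph G" "dominating_set G D" "v \<in> pverts G"
  shows "\<exists>D'. dominating_set G D' \<and> card D' = card D \<and> guard_response G D v D'"
proof -
  obtain A :: "'a monoid" and C where "comm_group A" "finite (carrier A)"
    "C \<subseteq> carrier A - {\<one>\<^bsub>A\<^esub>}" "C = m_inv A ` C" and G: "G = cayley_graph A C"
    using assms(1) unfolding abelian_cayley_graph_def by blast
  moreover have "v \<in> carrier A" using assms(3) by (simp add: G cayley_graph_def)
  ultimately show ?thesis
    using cayley_translate_response[of A C D v] assms(2) unfolding G by metis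
qed

lemma cayley_m_eternal_eq_domination:
  assumes G: "abelian_cayley_graph G"
  shows "domination_number G = m_eternal_domination_number G"
proof -
  note pg = abelian_cayley_pair_graph[OF G]
  obtain X where X: "dominating_set G X" "card X = domination_number G"
    using domination_number_attained[OF pg] .
  have "m_eternally_dominated G (domination_number G)"
  proof (rule m_eternally_dominatedI)
    show "X \<in> {D. dominating_set G D}" using X by simp
    show "card X = domination_number G" by (rule X)
    show "D \<subseteq> pverts G" if "D \<in> {D. dominating_set G D}" for D
      using that by (simp add: dominating_set_def)
    fix D v assume "D \<in> {D. dominating_set G D}" "v \<in> pverts G - D"
    then have "dominating_set G D" "v \<in> pverts G" by auto
    from cayley_dominating_response[OF G this]
    show "\<exists>D'\<in>{D. dominating_set G D}. guard_response G D v D'" by auto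
  qed
  then show ?thesis
    unfolding m_eternal_domination_number_def
    using domination_number_le_m_eternal[OF pg] by (intro Least_equality[symmetric])
qed

lemma cayley_fractional_le_domination:
  assumes G: "abelian_cayley_graph G"
  shows "eternally_fractionally_dominated G (real (domination_number G))"
proof -
  note pg = abelian_cayley_pair_graph[OF G]
  obtain X where X: "dominating_set G X" "card X = domination_number G"
    using domination_number_attained[OF pg] .
  let ?W = "indicator ` {D. dominating_set G D} :: ('a \<Rightarrow> real) set"
  show ?thesis
  proof (rule eternally_fractionally_dominatedI)
    show "indicator X \<in> ?W" using X by simp
    have "pverts G \<inter> X = X" using X by (auto simp: dominating_set_def)
    then show "sum (indicator X) (pverts G) \<le> real (domination_number G)"
      using X finite_pverts[OF pg] by (simp add: indicator_def sum.If_cases)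
    show "fractional_dominating G w" if "w \<in> ?W" for w
      using that fractional_dominating_indicator[OF pg] by auto
    fix w v assume "w \<in> ?W" and v: "v \<in> pverts G"
    then obtain D where D: "w = indicator D" "dominating_set G D" by auto
    then have "D \<subseteq> pverts G" by (simp add: dominating_set_def)
    moreover obtain D' where D': "dominating_set G D'" "guard_response G D v D'"
      using cayley_dominating_response[OF G D(2) v] by auto
    ultimately have "fractional_response G w v (indicator D')"
      unfolding D(1) by (rule fractional_response_guards[OF pg])
    then show "\<exists>w'\<in>?W. fractional_response G w v w'" using D'(1) by auto
  qed
qed


section \<open>Closed ladders\<close>

text \<open>
  \<open>p\<close> is a covering of the graph by the infinite ladder
  \<open>\<int> \<times> bool\<close>, whose first coordinate numbers the rungs (columns) and
  whose second one is the side (row); \<open>n\<close> is the number of rungs, and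
  \<open>t\<close> tells whether the two sides are interchanged after one turn. Indexing columns
  by all integers avoids modular arithmetic, and requiring injectivity on all windows of
  \<open>n\<close> columns keeps the notion invariant under translation and reflection.
\<close>

definition ladder ::
    "'a pair_pre_digraph \<Rightarrow> nat \<Rightarrow> bool \<Rightarrow> (int \<Rightarrow> bool \<Rightarrow> 'a) \<Rightarrow> bool" where
  "ladder G n t p \<longleftrightarrow> n > 0 \<and>
     pverts G = {p i e | i e. True} \<and>
     (\<forall>i e. nbhd G (p i e) = {p (i + 1) e, p (i - 1) e, p i (\<not> e)}) \<and>
     (\<forall>i e. p (i + int n) e = p i (e \<noteq> t)) \<and>
     (\<forall>i j e f. p i e = p j f \<longrightarrow> \<bar>i - j\<bar> < int n \<longrightarrow> i = j \<and> e = f)"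

context
  fixes G :: "'a pair_pre_digraph" and n :: nat and t :: bool and p :: "int \<Rightarrow> bool \<Rightarrow> 'a"
  assumes L: "ladder G n t p"
begin

lemma ladder_pos: "n > 0"
  and ladder_verts: "pverts G = {p i e | i e. True}"
  and ladder_nbhd: "nbhd G (p i e) = {p (i + 1) e, p (i - 1) e, p i (\<not> e)}"
  and ladder_period: "p (i + int n) e = p i (e \<noteq> t)"
  and ladder_inj: "p i e = p j f \<Longrightarrow> \<bar>i - j\<bar> < int n \<Longrightarrow> i = j \<and> e = f"
  using L unfolding ladder_def by blast+

lemma ladder_in_verts: "p i e \<in> pverts G"
  by (auto simp: ladder_verts)

lemma ladder_closed_nbhd: "closed_nbhd G (p i e) = {p i e, p (i + 1) e, p (i - 1) e, p i (\<not> e)}"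
  by (simp add: closed_nbhd_def ladder_nbhd)

lemma ladder_period_mult: "p (i + q * int n) e = p i (e \<noteq> (t \<and> odd q))"
proof (induction q arbitrary: e rule: int_induct[where k = 0])
  case base
  then show ?case by simp
next
  case (step1 q)
  have "p (i + (q + 1) * int n) e = p ((i + q * int n) + int n) e" by (simp add: algebra_simps)
  also have "\<dots> = p (i + q * int n) (e \<noteq> t)" by (rule ladder_period)
  also have "\<dots> = p i ((e \<noteq> t) \<noteq> (t \<and> odd q))" by (rule step1)
  finally show ?case by (cases e; cases t) auto
next
  case (step2 q)
  have "p (i + (q - 1) * int n) ((e \<noteq> t) \<noteq> t) = p ((i + (q - 1) * int n) + int n) (e \<noteq> t)"
    by (subst ladder_period) simp
  also have "\<dots> = p (i + q * int n) (e \<noteq> t)" by (simp add: algebra_simps)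
  also have "\<dots> = p i ((e \<noteq> t) \<noteq> (t \<and> odd q))" by (rule step2)
  finally show ?case by (cases e; cases t) auto
qed

text \<open>
  The pair \<open>(n, t)\<close> determines which points of the infinite ladder are identified,
  hence the graph up to isomorphism.
\<close>

lemma ladder_eq_iff: "p i e = p j f \<longleftrightarrow> (\<exists>q. i = j + q * int n \<and> (f \<longleftrightarrow> (e \<noteq> (t \<and> odd q))))"
proof
  assume eq: "p i e = p j f"
  define q where "q = (i - j) div int n"
  define r where "r = (i - j) mod int n"
  have r: "0 \<le> r" "r < int n" using ladder_pos by (auto simp: r_def)
  have i: "i = (j + r) + q * int n" by (simp add: q_def r_def algebra_simps)
  have "p (j + r) (e \<noteq> (t \<and> odd q)) = p j f"
    using eq ladder_period_mult[of "j + r" q e] i by simp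
  then have "j + r = j \<and> (e \<noteq> (t \<and> odd q)) = f" using r by (intro ladder_inj) auto
  then show "\<exists>q. i = j + q * int n \<and> (f \<longleftrightarrow> (e \<noteq> (t \<and> odd q)))" using i by auto
qed (auto simp: ladder_period_mult)

lemma ladder_shift: "ladder G n t (\<lambda>i e. p (i + k) (e \<noteq> s))"
  unfolding ladder_def
proof (intro conjI allI impI)
  show "pverts G = {p (i + k) (e \<noteq> s) | i e. True}"
    unfolding ladder_verts
  proof (intro equalityI subsetI)
    fix x assume "x \<in> {p i e | i e. True}"
    then obtain i e where "x = p i e" by blast
    then have "x = p ((i - k) + k) ((e \<noteq> s) \<noteq> s)" by (cases s) auto
    then show "x \<in> {p (i + k) (e \<noteq> s) | i e. True}" by blast
  qed blast
  fix i j e f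
  show "nbhd G (p (i + k) (e \<noteq> s)) = {p (i + 1 + k) (e \<noteq> s), p (i - 1 + k) (e \<noteq> s), p (i + k) ((\<not> e) \<noteq> s)}"
    by (auto simp: ladder_nbhd algebra_simps)
  show "p (i + int n + k) (e \<noteq> s) = p (i + k) ((e \<noteq> t) \<noteq> s)"
    using ladder_period[of "i + k" "e \<noteq> s"] by (cases s; cases t) (auto simp: algebra_simps)
  assume "p (i + k) (e \<noteq> s) = p (j + k) (f \<noteq> s)" "\<bar>i - j\<bar> < int n"
  then have "i + k = j + k \<and> (e \<noteq> s) = (f \<noteq> s)" by (intro ladder_inj) auto
  then show "i = j" "e = f" by auto
qed (rule ladder_pos)

lemma ladder_reflect: "ladder G n t (\<lambda>i. p (- i))"
  unfolding ladder_def
proof (intro conjI allI impI)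
  show "pverts G = {p (- i) e | i e. True}"
    unfolding ladder_verts by (auto, metis minus_minus)
  fix i j e f
  show "nbhd G (p (- i) e) = {p (- (i + 1)) e, p (- (i - 1)) e, p (- i) (\<not> e)}"
    by (auto simp: ladder_nbhd)
  show "p (- (i + int n)) e = p (- i) (e \<noteq> t)"
    using ladder_period[of "- (i + int n)" "e \<noteq> t"] by (cases t) auto
  assume "p (- i) e = p (- j) f" "\<bar>i - j\<bar> < int n"
  then have "- i = - j \<and> e = f" by (intro ladder_inj) auto
  then show "i = j" "e = f" by auto
qed (rule ladder_pos)

text \<open>
  Closed ladders are vertex-transitive, so any vertex may be taken as origin.
\<close>

lemma ladder_rebase:
  assumes "v \<in> pverts G"
  obtains p' where "ladder G n t p'" "p' 0 False = v"
proof -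
  obtain i e where "v = p i e" using assms by (auto simp: ladder_verts)
  then show ?thesis using that[OF ladder_shift[of i e]] by simp
qed

lemma ladder_fundamental_domain: "bij_betw (\<lambda>(i, e). p i e) ({0..<int n} \<times> UNIV) (pverts G)"
  unfolding bij_betw_def
proof
  show "inj_on (\<lambda>(i, e). p i e) ({0..<int n} \<times> UNIV)"
    by (intro inj_onI) (auto dest!: ladder_inj)
  show "(\<lambda>(i, e). p i e) ` ({0..<int n} \<times> UNIV) = pverts G"
  proof (intro equalityI subsetI)
    fix x assume "x \<in> pverts G"
    then obtain i e where x: "x = p i e" by (auto simp: ladder_verts)
    have "x = p (i mod int n + (i div int n) * int n) e" by (simp add: x)
    also have "\<dots> = p (i mod int n) (e \<noteq> (t \<and> odd (i div int n)))" by (rule ladder_period_mult)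
    finally show "x \<in> (\<lambda>(i, e). p i e) ` ({0..<int n} \<times> UNIV)" using ladder_pos by force
  qed (auto simp: ladder_in_verts)
qed

lemma ladder_card: "card (pverts G) = 2 * n"
proof -
  have "card (pverts G) = card ({0..<int n} \<times> (UNIV :: bool set))"
    using bij_betw_same_card[OF ladder_fundamental_domain] by simp
  then show ?thesis by (simp add: card_cartesian_product)
qed

text \<open>
  With fewer columns, two of the three neighbours of a vertex coincide.
\<close>

lemma ladder_cubic:
  assumes "cubic G"
  shows "n \<ge> 2" "n = 2 \<Longrightarrow> t"
proof -
  have c: "card {p 1 False, p (- 1) False, p 0 True} = 3"
    using assms ladder_in_verts[of 0 False] ladder_nbhd[of 0 False] unfolding cubic_def by force
  have ne: "p 1 False \<noteq> p 0 True" "p 1 False \<noteq> p (- 1) False"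
  proof -
    have "card {x, y, y} \<noteq> 3" "card {x, x, y} \<noteq> 3" "card {x, y, x} \<noteq> 3" for x y :: 'a
      by (auto simp: card_insert_if)
    then show "p 1 False \<noteq> p 0 True" "p 1 False \<noteq> p (- 1) False" using c by metis+
  qed
  show "n \<ge> 2"
  proof (rule ccontr)
    assume "\<not> n \<ge> 2"
    then have "n = 1" using ladder_pos by simp
    then have "p 1 False = p 0 t" "p 0 False = p (- 1) t" "p (- 1) True = p 0 (\<not> t)"
      using ladder_period[of 0 False] ladder_period[of "-1" False] ladder_period[of "-1" True]
      by (auto, metis)
    then have "card {p 1 False, p (- 1) False, p 0 True} \<noteq> 3"
      using ne by (cases t) (auto simp: card_insert_if)
    then show False using c by simp
  qed
  show t if "n = 2"
  proof (rule ccontr)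
    assume "\<not> t"
    then have "p 1 False = p (- 1) False" using ladder_period[of "-1" False] that by simp
    then show False using ne by simp
  qed
qed

end


section \<open>The domination number of a closed ladder\<close>

text \<open>
  Put \<open>v\<close> at column 0. The closed neighbourhoods of the vertices in columns
  \<open>1, 3, 5, \<dots>\<close>, on alternating sides, are disjoint: each one contains its
  whole column but only one vertex of either adjacent column, and consecutive ones use different
  vertices of the column between them. They avoid \<open>v\<close>, and each one contributes at
  least 1.
\<close>

lemma ladder_weight_ge:
  assumes L: "ladder G n t p" and pg: "pair_graph G"
    and w: "fractional_dominating G w" and v: "v \<in> pverts G" "w v \<ge> 1"
  shows "sum w (pverts G) \<ge> real ((n + 1) div 2)"
proof -
  obtain p where L: "ladder G n t p" and p0: "p 0 False = v"
    using ladder_rebase[OF L v(1)] .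
  define N where "N j = closed_nbhd G (p (2 * int j + 1) (even j))" for j :: nat
  define J where "J = {j. 2 * j + 2 < n}"
  have "J = {..<(n - 1) div 2}" by (auto simp: J_def)
  then have cardJ: "card J = (n - 1) div 2" and finJ: "finite J" by auto
  have N: "N j = {p (2 * int j + 1) (even j), p (2 * int j + 2) (even j), p (2 * int j) (even j),
      p (2 * int j + 1) (odd j)}" for j
    by (simp add: N_def ladder_closed_nbhd[OF L] add.commute)
  have disj: "N j \<inter> N k = {}" if "j \<in> J" "k \<in> J" "j \<noteq> k" for j k
  proof -
    have 1: "p a e = p b f \<Longrightarrow> a = b \<and> e = f" if "0 \<le> a" "0 \<le> b" "a < int n" "b < int n" for a b e f
      using ladder_inj[OF L] that by auto
    have "x \<notin> N k" if x: "x \<in> N j" for x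
    proof
      assume y: "x \<in> N k"
      obtain a e where a: "x = p a e" "a \<in> {2 * int j .. 2 * int j + 2}" "a \<noteq> 2 * int j + 1 \<Longrightarrow> e = even j"
        using x unfolding N by auto
      obtain b f where b: "x = p b f" "b \<in> {2 * int k .. 2 * int k + 2}" "b \<noteq> 2 * int k + 1 \<Longrightarrow> f = even k"
        using y unfolding N by auto
      have ab: "a = b" "e = f"
        using 1[of a b e f] a b \<open>j \<in> J\<close> \<open>k \<in> J\<close> by (auto simp: J_def)
      then have "j = k + 1 \<or> k = j + 1" using a(2) b(2) \<open>j \<noteq> k\<close> by auto
      then show False using ab a(2,3) b(2,3) by auto
    qed
    then show ?thesis by blast
  qed
  have sub: "N j \<subseteq> pverts G - {v}" if "j \<in> J" for j
  proof -
    have "p 0 False \<noteq> p b f" if "b < int n" "0 \<le> b" "b \<noteq> 0 \<or> f" for b f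
      using ladder_inj[OF L, of 0 False b f] that by auto
    then have "v \<notin> N j" using \<open>j \<in> J\<close> unfolding N p0[symmetric] by (auto simp: J_def)
    then show ?thesis using closed_nbhd_subset[OF pg] ladder_in_verts[OF L] unfolding N_def by blast
  qed
  have fin: "finite (N j)" for j by (simp add: N)
  have "real (card J) = (\<Sum>j\<in>J. 1)" by simp
  also have "\<dots> \<le> (\<Sum>j\<in>J. sum w (N j))"
    using w ladder_in_verts[OF L] by (intro sum_mono) (auto simp: fractional_dominating_def N_def)
  also have "\<dots> = sum w (\<Union>j\<in>J. N j)"
    using disj finJ fin by (intro sum.UNION_disjoint[symmetric]) auto
  also have "\<dots> \<le> sum w (pverts G - {v})"
    using finite_pverts[OF pg] sub w by (intro sum_mono2) (auto simp: fractional_dominating_def)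
  finally have "1 + real (card J) \<le> w v + sum w (pverts G - {v})" using v by simp
  also have "\<dots> = sum w (pverts G)" using finite_pverts[OF pg] v by (simp add: sum.remove)
  finally show ?thesis using cardJ ladder_pos[OF L] by (cases n) auto
qed

text \<open>
  The closed ladders in which every second column is meant to be occupied on alternating sides
  but the sides do not match after one turn: there are \<open>n / 2\<close> occupied columns,
  and the mismatch happens if their number is odd without a twist, or even with a twist.
\<close>

definition frustrated :: "nat \<Rightarrow> bool \<Rightarrow> bool" where
  "frustrated n t \<longleftrightarrow> even n \<and> (t \<longleftrightarrow> 4 dvd n)"

text \<open>
  A vertex in an odd column lies between two chosen vertices on different sides and is adjacent
  to one of them. Only the last column of an even ladder needs the wrap-around, which matches by
  assumption.
\<close>

lemma domination_number_le_if_not_frustrated: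
  assumes L: "ladder G n t p" and pg: "pair_graph G" and nf: "\<not> frustrated n t"
  shows "domination_number G \<le> (n + 1) div 2"
proof -
  define c where "c j = p (2 * int j) (odd j)" for j
  define D where "D = c ` {..<(n + 1) div 2}"
  have dom: "\<exists>u\<in>D. v \<in> closed_nbhd G u" if "v \<in> pverts G" for v
  proof -
    have "v \<in> (\<lambda>(i, e). p i e) ` ({0..<int n} \<times> UNIV)"
      using that bij_betw_imp_surj_on[OF ladder_fundamental_domain[OF L]] by simp
    then obtain i e where v: "0 \<le> i" "i < int n" "v = p i e" by auto
    define k where "k = nat i"
    have k: "i = int k" "k < n" using v by (auto simp: k_def)
    show ?thesis
    proof (cases "even k")
      case True
      then obtain j where j: "k = 2 * j" by blast
      then have "c j \<in> D" using k by (auto simp: D_def)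
      moreover have "v \<in> closed_nbhd G (c j)"
        by (cases "e = odd j") (auto simp: c_def ladder_closed_nbhd[OF L] v k j)
      ultimately show ?thesis by blast
    next
      case False
      then obtain j where j: "k = 2 * j + 1" by (metis oddE)
      show ?thesis
      proof (cases "e = odd j")
        case True
        then have "v \<in> closed_nbhd G (c j)"
          by (simp add: c_def ladder_closed_nbhd[OF L] v k j add.commute)
        moreover have "c j \<in> D" using k j by (auto simp: D_def)
        ultimately show ?thesis by blast
      next
        case e: False
        then have nb: "v \<in> closed_nbhd G (c (j + 1))"
          by (auto simp: c_def ladder_closed_nbhd[OF L] v k j)
        show ?thesis
        proof (cases "k + 1 < n")
          case True
          then have "c (j + 1) \<in> D" using j by (auto simp: D_def)
          then show ?thesis using nb by blast
        next
          case False
          then have n: "n = 2 * j + 2" using k j by simp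
          have "4 dvd n \<longleftrightarrow> odd j"
            unfolding n by presburger
          then have t: "t \<longleftrightarrow> even j" using nf n by (auto simp: frustrated_def)
          \<comment> \<open>The next chosen vertex is the one of column 0, one turn later.\<close>
          have "c (j + 1) = p (0 + int n) (even j)" by (simp add: c_def n)
          also have "\<dots> = c 0" unfolding ladder_period[OF L] using t by (simp add: c_def)
          finally have "c (j + 1) \<in> D" using n by (auto simp: D_def)
          then show ?thesis using nb by blast
        qed
      qed
    qed
  qed
  have "dominating_set G D"
    using dom by (intro dominating_setI[OF pg]) (auto simp: D_def c_def ladder_in_verts[OF L])
  then have "domination_number G \<le> card D" by (rule domination_number_le)
  also have "\<dots> \<le> (n + 1) div 2" unfolding D_def using card_image_le[of "{..<(n + 1) div 2}" c] by simp
  finally show ?thesis .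
qed

text \<open>
  Closed neighbourhoods have four elements; a single overlap would make them too few to cover
  the graph.
\<close>

lemma tight_dominating_set_is_perfect:
  assumes pg: "pair_graph G" and cub: "cubic G" and D: "dominating_set G D"
    and tight: "4 * card D \<le> card (pverts G)"
    and u: "u \<in> D" "u' \<in> D" and x: "x \<in> closed_nbhd G u" "x \<in> closed_nbhd G u'"
  shows "u = u'"
proof (rule ccontr)
  assume ne: "u \<noteq> u'"
  have sub: "D \<subseteq> pverts G" and cover: "(\<Union>u\<in>D. closed_nbhd G u) = pverts G"
    using D by (auto simp: dominating_set_def)
  have fin: "finite D" using sub finite_pverts[OF pg] finite_subset by blast
  have four: "card (closed_nbhd G z) = 4" if "z \<in> D" for z
    using that sub cub finite_nbhd[OF pg, of z] nbhd_irrefl[OF pg, of z]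
    by (auto simp: closed_nbhd_def cubic_def)
  let ?R = "D - {u, u'}"
  have "pverts G = (closed_nbhd G u \<union> closed_nbhd G u') \<union> (\<Union>z\<in>?R. closed_nbhd G z)"
    using cover u by blast
  then have "card (pverts G) \<le> card (closed_nbhd G u \<union> closed_nbhd G u') + card (\<Union>z\<in>?R. closed_nbhd G z)"
    by (metis card_Un_le)
  moreover have "card (closed_nbhd G u \<union> closed_nbhd G u') + card (closed_nbhd G u \<inter> closed_nbhd G u') = 8"
    using card_Un_Int[OF finite_closed_nbhd[OF pg] finite_closed_nbhd[OF pg], of u u'] four u by simp
  moreover have "card (closed_nbhd G u \<inter> closed_nbhd G u') > 0"
    using x finite_closed_nbhd[OF pg] by (auto simp: card_gt_0_iff)
  moreover have "card (\<Union>z\<in>?R. closed_nbhd G z) \<le> (\<Sum>z\<in>?R. card (closed_nbhd G z))"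
    using fin by (intro card_UN_le) simp
  moreover have "(\<Sum>z\<in>?R. card (closed_nbhd G z)) = 4 * (card D - 2)"
    using four ne u fin by (simp add: card_Diff_subset)
  moreover have "card D \<ge> 2"
    using card_mono[of D "{u, u'}"] u ne fin by simp
  ultimately show False using tight by simp
qed

text \<open>
  In a perfect code, a code vertex at column \<open>i\<close> forces the vertex on the other
  side at column \<open>i + 2\<close>: it is the only one that can dominate the opposite vertex
  of column \<open>i + 1\<close> without an overlap. Following this once around the ladder puts
  both ends of a rung into the code.
\<close>

lemma domination_number_gt_if_frustrated:
  assumes L: "ladder G n t p" and pg: "pair_graph G" and cub: "cubic G" and fr: "frustrated n t"
  shows "domination_number G > n div 2"
proof (rule ccontr)
  assume "\<not> domination_number G > n div 2"
  moreover obtain D where D: "dominating_set G D" "card D = domination_number G"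
    using domination_number_attained[OF pg] .
  ultimately have tight: "4 * card D \<le> card (pverts G)" using ladder_card[OF L] by simp
  note perfect = tight_dominating_set_is_perfect[OF pg cub D(1) tight]
  have sub: "D \<subseteq> pverts G" using D by (simp add: dominating_set_def)
  have "D \<noteq> {}" using D ladder_in_verts[OF L] by (auto simp: dominating_set_def)
  then obtain v where v: "v \<in> D" by blast
  then obtain p where L: "ladder G n t p" and p0: "p 0 False = v"
    using ladder_rebase[OF L] sub by blast
  have n2: "n \<ge> 2" using ladder_cubic[OF L cub] by simp
  have step: "p (i + 2) (\<not> e) \<in> D" if i: "p i e \<in> D" for i e
  proof -
    have "p (i + 1) (\<not> e) \<in> pverts G" by (rule ladder_in_verts[OF L])
    then obtain u where u: "u \<in> D" "p (i + 1) (\<not> e) \<in> closed_nbhd G u"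
      using D(1) unfolding dominating_set_def by blast
    then have "u \<in> closed_nbhd G (p (i + 1) (\<not> e))" using closed_nbhd_sym[OF pg] by blast
    then have "u \<in> {p (i + 1) (\<not> e), p (i + 2) (\<not> e), p i (\<not> e), p (i + 1) e}"
      unfolding ladder_closed_nbhd[OF L] by (simp add: add.commute)
    moreover have "u \<noteq> p i (\<not> e)"
    proof
      assume "u = p i (\<not> e)"
      then have "p i e = u" using perfect[OF i u(1), of u] by (auto simp: ladder_closed_nbhd[OF L])
      then show False using \<open>u = p i (\<not> e)\<close> ladder_inj[OF L, of i e i "\<not> e"] n2 by auto
    qed
    moreover have "u \<noteq> p (i + 1) f" for f
    proof
      assume f: "u = p (i + 1) f"
      have "p (i + 1) e \<in> closed_nbhd G u" "p (i + 1) e \<in> closed_nbhd G (p i e)"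
        by (cases "f = e"; auto simp: f ladder_closed_nbhd[OF L])+
      then have "p i e = u" using perfect[OF i u(1)] by blast
      then show False using f ladder_inj[OF L, of i e "i + 1" f] n2 by auto
    qed
    ultimately show ?thesis using u(1) by auto
  qed
  have all: "p (2 * int j) (odd j) \<in> D" for j
  proof (induction j)
    case 0
    then show ?case using v p0 by simp
  next
    case (Suc j)
    then show ?case using step[of "2 * int j" "odd j"] by (simp add: algebra_simps)
  qed
  have half: "2 * int (n div 2) = int n" using fr by (auto simp: frustrated_def)
  have "p (0 + int n) (odd (n div 2)) \<in> D"
    using all[of "n div 2"] unfolding half by simp
  moreover have "4 dvd n \<longleftrightarrow> even (n div 2)" using fr unfolding frustrated_def by (elim conjE) presburger
  ultimately have "p 0 True \<in> D"
    using fr unfolding ladder_period[OF L] by (auto simp: frustrated_def)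
  then have "p 0 True = p 0 False"
    using perfect[of "p 0 True" "p 0 False" "p 0 True"] v p0 by (auto simp: ladder_closed_nbhd[OF L])
  then show False using ladder_inj[OF L, of 0 True 0 False] n2 by auto
qed


section \<open>A fractional strategy on closed ladders\<close>

text \<open>
  The positions of the fractional defender: enough weight everywhere to dominate, and the rest
  of a full unit at the vertex attacked last.
\<close>

definition focus :: "'a \<Rightarrow> 'a \<Rightarrow> real" where
  "focus u x = (if x = u then 1 else 1/4)"

lemma focus_total:
  assumes "finite V" "u \<in> V"
  shows "sum (focus u) V = (real (card V) + 3) / 4"
proof -
  have "sum (focus u) V = focus u u + sum (focus u) (V - {u})"
    using assms by (simp add: sum.remove)
  also have "sum (focus u) (V - {u}) = (\<Sum>x\<in>V - {u}. 1/4)"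
    by (intro sum.cong) (auto simp: focus_def)
  also have "focus u u + \<dots> = (real (card V) + 3) / 4"
  proof -
    have "real (card (V - {u})) = real (card V) - 1"
      using assms card_gt_0_iff[of V] by (auto simp: of_nat_diff)
    then show ?thesis by (simp add: focus_def field_simps)
  qed
  finally show ?thesis .
qed

lemma focus_dominating:
  assumes pg: "pair_graph G" and cub: "cubic G"
  shows "fractional_dominating G (focus u)"
  unfolding fractional_dominating_def
proof (intro conjI ballI)
  fix v assume v: "v \<in> pverts G"
  have "card (closed_nbhd G v) = 4"
    using v cub finite_nbhd[OF pg, of v] nbhd_irrefl[OF pg, of v]
    by (auto simp: closed_nbhd_def cubic_def)
  then have "1 = (\<Sum>x\<in>closed_nbhd G v. 1/4 :: real)" by simp
  also have "\<dots> \<le> sum (focus u) (closed_nbhd G v)"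
    by (intro sum_mono) (auto simp: focus_def)
  finally show "1 \<le> sum (focus u) (closed_nbhd G v)" .
qed (auto simp: focus_def)

text \<open>
  \<open>M\<close> is to be thought of as the arcs of three paths from \<open>u\<close> to
  \<open>v\<close> whose inner vertices are the distinct elements of \<open>X\<close>. Each
  inner vertex passes on exactly the \<open>1/4\<close> that it owns.
\<close>

lemma focus_response_flow:
  assumes pg: "pair_graph G" and cub: "cubic G"
    and M: "set_mset M \<subseteq> parcs G"
    and out: "image_mset fst M = {#u, u, u#} + mset_set X"
    and inn: "image_mset snd M = {#v, v, v#} + mset_set X"
  shows "fractional_response G (focus u) v (focus v)"
proof (rule fractional_response_arcs[OF pg M, of "1/4"])
  have "count (mset_set X) x \<le> 1" for x by (simp add: count_mset_set')
  then have c: "real (count (mset_set X) x) \<le> 1" for x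
    by (metis of_nat_1 of_nat_le_iff)
  show "1/4 * real (count (image_mset fst M) x) \<le> focus u x" for x
    using c[of x] by (cases "x = u") (simp_all add: out focus_def)
  show "focus v x = focus u x - 1/4 * real (count (image_mset fst M) x)
      + 1/4 * real (count (image_mset snd M) x)" for x
    by (simp add: out inn focus_def field_simps)
qed (use focus_dominating[OF pg cub] in \<open>auto simp: focus_def\<close>)

definition strand :: "(nat \<Rightarrow> 'a) \<Rightarrow> nat \<Rightarrow> ('a \<times> 'a) multiset" where
  "strand f k = mset (map (\<lambda>j. (f j, f (Suc j))) [0..<k])"

lemma strand_fst: "k > 0 \<Longrightarrow> image_mset fst (strand f k) = {#f 0#} + mset (map f [1..<k])"
  by (simp add: strand_def multiset.map_comp comp_def upt_conv_Cons flip: mset_map)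

lemma strand_snd: "k > 0 \<Longrightarrow> image_mset snd (strand f k) = {#f k#} + mset (map f [1..<k])"
proof -
  assume "k > 0"
  have "map (\<lambda>j. f (Suc j)) [0..<k] = map f (map Suc [0..<k])" by simp
  also have "map Suc [0..<k] = [1..<k] @ [k]" using \<open>k > 0\<close> by (simp add: map_Suc_upt)
  finally show ?thesis
    by (simp add: strand_def multiset.map_comp comp_def flip: mset_map)
qed

lemma set_strand: "set_mset (strand f k) = {(f j, f (Suc j)) | j. j < k}"
  by (auto simp: strand_def)

context
  fixes G :: "'a pair_pre_digraph" and n :: nat and t :: bool and p :: "int \<Rightarrow> bool \<Rightarrow> 'a"
  assumes L: "ladder G n t p" and pg: "pair_graph G" and cub: "cubic G"
begin

lemma ladder_arcs:
  "j = i + 1 \<or> j = i - 1 \<Longrightarrow> (p i e, p j e) \<in> parcs G" "(p i e, p i (\<not> e)) \<in> parcs G"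
  using ladder_nbhd[OF L, of i e] by (auto simp: nbhd_def set_eq_iff)

text \<open>
  The vertices are the two ends of a rung. The three paths are the rung itself and the detours
  over the two adjacent rungs, which are different because \<open>n \<ge> 3\<close>.
\<close>

lemma focus_response_opposite:
  assumes n: "n \<ge> 3"
  shows "fractional_response G (focus (p 0 False)) (p 0 True) (focus (p 0 True))"
proof -
  let ?P = "\<lambda>(i, e). p i e"
  let ?cs = "[(1, False), (1, True), (- 1, False), (- 1, True)] :: (int \<times> bool) list"
  let ?X = "set (map ?P ?cs)"
  let ?M = "mset [(p 0 False, p 0 True),
    (p 0 False, p 1 False), (p 1 False, p 1 True), (p 1 True, p 0 True),
    (p 0 False, p (- 1) False), (p (- 1) False, p (- 1) True), (p (- 1) True, p 0 True)]"
  have "distinct (map ?P ?cs)"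
    unfolding distinct_map
  proof
    have "inj_on ?P ({- 1..1} \<times> UNIV)"
      using n by (intro inj_onI) (auto dest!: ladder_inj[OF L])
    then show "inj_on ?P (set ?cs)" by (rule inj_on_subset) auto
  qed simp
  then have X: "mset_set ?X = mset (map ?P ?cs)" by (rule mset_set_set)
  show ?thesis
  proof (rule focus_response_flow[OF pg cub])
    show "set_mset ?M \<subseteq> parcs G"
      using ladder_arcs(1) ladder_arcs(2)[of _ False] by simp
    show "image_mset fst ?M = {#p 0 False, p 0 False, p 0 False#} + mset_set ?X"
      unfolding X by simp
    show "image_mset snd ?M = {#p 0 True, p 0 True, p 0 True#} + mset_set ?X"
      unfolding X by simp
  qed
qed

text \<open>
  Given one path to \<open>p i e\<close> inside the columns between 0 and \<open>i\<close>, the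
  other two go the other way round, along both sides at once, from column 0 to column
  \<open>i - n\<close>. Together with the rungs at both ends they need no case distinction:
  whichever side arrives at the wrong end of the last rung crosses it.
\<close>

lemma focus_response_single_strand:
  assumes i: "0 < i" "i < int n"
    and M: "set_mset M \<subseteq> parcs G"
    and out: "image_mset fst M = {#p 0 False#} + mset (map (\<lambda>(j, f). p j f) cs)"
    and inn: "image_mset snd M = {#p i e#} + mset (map (\<lambda>(j, f). p j f) cs)"
    and cs: "distinct cs" "set cs \<subseteq> {1..<i} \<times> UNIV"
  shows "fractional_response G (focus (p 0 False)) (p i e) (focus (p i e))"
proof -
  let ?P = "\<lambda>(j, f). p j f"
  define m where "m = nat (int n - i)"
  have m: "m > 0" "int m = int n - i" using i by (auto simp: m_def)
  let ?row = "\<lambda>f j. p (- int j) f"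
  let ?crow = "\<lambda>f j. (- int j, f)"
  \<comment> \<open>The end of the last rung that is not \<open>p i e\<close>, in the coordinates of the columns \<open>i - n, \<dots>, i - 1\<close>,
    a window of \<open>n\<close> columns that contains all inner vertices of the three paths.\<close>
  define cv where "cv = (i - int n, (\<not> e) \<noteq> t)"
  let ?cs = "cs @ map (?crow False) [1..<m] @ map (?crow True) [1..<m] @ [(0, True), cv]"
  have end_row: "p (i - int n) f = p i (f \<noteq> t)" for f
    using ladder_period[OF L, of "i - int n" "f \<noteq> t"] by (cases t) auto
  have cv: "?P cv = p i (\<not> e)" by (cases t) (auto simp: cv_def end_row)
  have "distinct (map ?P ?cs)"
    unfolding distinct_map
  proof
    have "inj_on ?P ({i - int n..<i} \<times> UNIV)"
      by (intro inj_onI) (auto dest!: ladder_inj[OF L])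
    then show "inj_on ?P (set ?cs)"
      using cs i m by (elim inj_on_subset) (auto simp: cv_def)
    show "distinct ?cs" using cs i m by (auto simp: distinct_map inj_on_def cv_def)
  qed
  then have X: "mset_set (set (map ?P ?cs)) = mset (map ?P ?cs)" by (rule mset_set_set)
  let ?M = "M + strand (?row False) m + strand (?row True) m
      + {#(p 0 False, p 0 True), (p i (\<not> e), p i e)#}"
  show ?thesis
  proof (rule focus_response_flow[OF pg cub])
    show "set_mset ?M \<subseteq> parcs G"
      using M ladder_arcs(2)[of 0 False] ladder_arcs(2)[of i "\<not> e"]
      by (auto simp: set_strand intro!: ladder_arcs(1))
    show "image_mset fst ?M = {#p 0 False, p 0 False, p 0 False#} + mset_set (set (map ?P ?cs))"
      unfolding X using cv by (simp add: out strand_fst[OF m(1)] comp_def)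
    have "p (- int m) False = p i t" "p (- int m) True = p i (\<not> t)"
      using end_row[of False] end_row[of True] m(2) by auto
    then have "{#p (- int m) False, p (- int m) True#} = {#p i e, p i (\<not> e)#}"
      by (cases e; cases t) auto
    then show "image_mset snd ?M = {#p i e, p i e, p i e#} + mset_set (set (map ?P ?cs))"
      unfolding X using cv by (simp add: inn strand_snd[OF m(1)] comp_def add_mset_commute)
  qed
qed

text \<open>
  The single path stays on its side, or changes sides in column 1, for which it needs a column
  strictly between 0 and \<open>i\<close>.
\<close>

lemma focus_response_column:
  assumes i: "0 < i" "i < int n" and e: "\<not> e \<or> i \<ge> 2"
  shows "fractional_response G (focus (p 0 False)) (p i e) (focus (p i e))"
proof (cases e)
  case False
  let ?k = "nat i"
  let ?f = "\<lambda>j. p (int j) False"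
  show ?thesis
  proof (rule focus_response_single_strand[OF i,
        where M = "strand ?f ?k" and cs = "map (\<lambda>j. (int j, False)) [1..<?k]"])
    show "set_mset (strand ?f ?k) \<subseteq> parcs G"
      by (auto simp: set_strand intro!: ladder_arcs(1))
  qed (use i False in \<open>auto simp: strand_fst strand_snd distinct_map inj_on_def comp_def simp flip: mset_map\<close>)
next
  case True
  let ?k = "nat i - 1"
  let ?f = "\<lambda>j. p (1 + int j) True"
  have k: "?k > 0" "1 + int ?k = i" using e True by auto
  show ?thesis
  proof (rule focus_response_single_strand[OF i,
        where M = "{#(p 0 False, p 1 False), (p 1 False, p 1 True)#} + strand ?f ?k"
          and cs = "[(1, False), (1, True)] @ map (\<lambda>j. (1 + int j, True)) [1..<?k]"])
    show "set_mset ({#(p 0 False, p 1 False), (p 1 False, p 1 True)#} + strand ?f ?k) \<subseteq> parcs G"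
      using ladder_arcs(2)[of 1 False] by (auto simp: set_strand intro!: ladder_arcs(1))
  qed (use i True k in \<open>auto simp: strand_fst strand_snd distinct_map inj_on_def comp_def simp flip: mset_map\<close>)
qed

end

text \<open>
  The only position that the preceding constructions miss is the vertex diagonally next to
  \<open>u\<close>, in column 1. Seen in the other direction it lies in column
  \<open>n - 1 \<ge> 2\<close>.
\<close>

lemma focus_response:
  assumes L: "ladder G n t p" and pg: "pair_graph G" and cub: "cubic G" and n: "n \<ge> 3"
    and u: "u \<in> pverts G" and v: "v \<in> pverts G"
  shows "fractional_response G (focus u) v (focus v)"
proof (cases "u = v")
  case True
  then show ?thesis
    using fractional_response_arcs[OF pg, of "{#}" 0 "focus u" "focus v" v] focus_dominating[OF pg cub]
    by (simp add: focus_def)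
next
  case False
  obtain p where L: "ladder G n t p" and p0: "p 0 False = u"
    using ladder_rebase[OF L u] .
  have "v \<in> (\<lambda>(i, e). p i e) ` ({0..<int n} \<times> UNIV)"
    using v bij_betw_imp_surj_on[OF ladder_fundamental_domain[OF L]] by simp
  then obtain i e where i: "0 \<le> i" "i < int n" and v: "v = p i e" by auto
  consider "i = 0" "e" | "i = 1" "e" | "0 < i" "\<not> e \<or> i \<ge> 2"
    using False i v p0 by (cases e; cases "i = 0"; cases "i = 1") auto
  then show ?thesis
  proof cases
    case 1
    then show ?thesis
      using focus_response_opposite[OF L pg cub n] p0 v by simp
  next
    case 2
    have "p (- (int n - 1)) (\<not> t) = p i e"
      using ladder_period[OF L, of "- (int n - 1)" True] 2 by (cases t) auto
    then show ?thesis
      using focus_response_column[OF ladder_reflect[OF L] pg cub, of "int n - 1" "\<not> t"] n p0 v by simp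
  next
    case 3
    then show ?thesis
      using focus_response_column[OF L pg cub, of i e] i p0 v by simp
  qed
qed

lemma fractional_eternal_le_focus:
  assumes L: "ladder G n t p" and pg: "pair_graph G" and cub: "cubic G" and n: "n \<ge> 3"
  shows "eternally_fractionally_dominated G ((2 * real n + 3) / 4)"
proof (rule eternally_fractionally_dominatedI[where W = "focus ` pverts G"])
  show "focus (p 0 False) \<in> focus ` pverts G" using ladder_in_verts[OF L] by simp
  show "sum (focus (p 0 False)) (pverts G) \<le> (2 * real n + 3) / 4"
    using focus_total[OF finite_pverts[OF pg] ladder_in_verts[OF L]] ladder_card[OF L] by simp
  show "fractional_dominating G w" if "w \<in> focus ` pverts G" for w
    using that focus_dominating[OF pg cub] by auto
  show "\<exists>w'\<in>focus ` pverts G. fractional_response G w v w'"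
    if "w \<in> focus ` pverts G" "v \<in> pverts G" for w v
    using that focus_response[OF L pg cub n] by auto
qed


section \<open>Isomorphisms of closed ladders; prisms and Moebius ladders\<close>

lemma graph_isoI:
  assumes G: "pair_wf_digraph G" and H: "pair_wf_digraph H"
    and h: "bij_betw h (pverts G) (pverts H)"
    and nb: "\<And>x. x \<in> pverts G \<Longrightarrow> nbhd H (h x) = h ` nbhd G x"
  shows "graph_iso G H"
proof -
  interpret G: pair_wf_digraph G by fact
  interpret H: pair_wf_digraph H by fact
  let ?f = "\<lparr>iso_verts = h, iso_arcs = map_prod h h, iso_head = snd, iso_tail = fst\<rparr>"
  have inj: "inj_on h (pverts G)" and onto: "h ` pverts G = pverts H"
    using h by (auto simp: bij_betw_def)
  have "inj_on (map_prod h h) (pverts G \<times> pverts G)"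
    using inj by (rule map_prod_inj_on[OF _ inj])
  then have inj_arcs: "inj_on (map_prod h h) (parcs G)"
    by (rule inj_on_subset) (auto dest: G.in_arcsD1 G.in_arcsD2)
  have arcs: "map_prod h h ` parcs G = parcs H"
  proof (intro equalityI subsetI)
    fix e assume "e \<in> map_prod h h ` parcs G"
    then obtain x y where e: "e = (h x, h y)" "(x, y) \<in> parcs G" by auto
    then have "h y \<in> nbhd H (h x)" using nb[OF G.in_arcsD1[OF e(2)]] by (auto simp: nbhd_def)
    then show "e \<in> parcs H" by (simp add: e nbhd_def)
  next
    fix e assume e: "e \<in> parcs H"
    obtain x' y' where e': "e = (x', y')" by (cases e)
    then obtain x where x: "x \<in> pverts G" "x' = h x" using H.in_arcsD1 e onto by blast
    then have "y' \<in> h ` nbhd G x" using e e' nb[OF x(1)] by (auto simp: nbhd_def)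
    then show "e \<in> map_prod h h ` parcs G" by (auto simp: nbhd_def e' x)
  qed
  have "wf_digraph (with_proj G)" by unfold_locales
  then have "pre_digraph.digraph_isomorphism (with_proj G) ?f"
    using inj inj_arcs by (simp add: pre_digraph.digraph_isomorphism_def)
  moreover have "with_proj H = app_iso ?f (with_proj G)"
    by (simp add: app_iso_def with_proj_def arcs onto)
  ultimately show ?thesis unfolding graph_iso_def digraph_iso_def by blast
qed

lemma graph_isoE:
  assumes "graph_iso G H"
  obtains h where "bij_betw h (pverts G) (pverts H)"
    "\<And>x. x \<in> pverts G \<Longrightarrow> nbhd G x \<subseteq> pverts G"
    "\<And>x. x \<in> pverts G \<Longrightarrow> nbhd H (h x) = h ` nbhd G x"
proof -
  obtain f where f: "pre_digraph.digraph_isomorphism (with_proj G) f"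
    and H: "with_proj H = app_iso f (with_proj G)"
    using assms unfolding graph_iso_def digraph_iso_def by blast
  let ?h = "iso_verts f"
  have "wf_digraph (with_proj G)" using f by (simp add: pre_digraph.digraph_isomorphism_def)
  then interpret pair_wf_digraph G by (simp add: wf_digraph_wp_iff)
  have inj: "inj_on ?h (pverts G)"
    using f by (simp add: pre_digraph.digraph_isomorphism_def)
  have HV: "pverts H = ?h ` pverts G" using arg_cong[OF H, of verts] by simp
  have HA: "parcs H = iso_arcs f ` parcs G" using arg_cong[OF H, of arcs] by simp
  have "iso_tail f = fst" "iso_head f = snd"
    using arg_cong[OF H, of tail] arg_cong[OF H, of head] by simp_all
  then have "iso_arcs f a = map_prod ?h ?h a" if "a \<in> parcs G" for a
    using f that unfolding pre_digraph.digraph_isomorphism_def by (auto simp: prod_eq_iff)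
  then have HA: "parcs H = map_prod ?h ?h ` parcs G" unfolding HA by (rule image_cong[OF refl])
  show ?thesis
  proof (rule that[of ?h])
    show "bij_betw ?h (pverts G) (pverts H)" using inj by (simp add: bij_betw_def HV)
    fix x assume x: "x \<in> pverts G"
    show "nbhd G x \<subseteq> pverts G" by (auto simp: nbhd_def dest: in_arcsD2)
    show "nbhd H (?h x) = ?h ` nbhd G x"
    proof (intro equalityI subsetI)
      fix y' assume "y' \<in> nbhd H (?h x)"
      then obtain a b where ab: "(a, b) \<in> parcs G" "?h a = ?h x" "y' = ?h b"
        by (auto simp: nbhd_def HA)
      then have "a = x" using inj_onD[OF inj] in_arcsD1 x by blast
      then show "y' \<in> ?h ` nbhd G x" using ab by (auto simp: nbhd_def)
    qed (auto simp: nbhd_def HA)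
  qed
qed

text \<open>
  Both ladders identify the same points of the infinite ladder, so
  \<open>p i e \<mapsto> q i e\<close> is well defined and bijective.
\<close>

lemma ladder_iso:
  assumes LG: "ladder G n t p" and G: "pair_wf_digraph G"
    and LH: "ladder H n t q" and H: "pair_wf_digraph H"
  shows "graph_iso G H"
proof -
  have eq: "p i e = p j f \<longleftrightarrow> q i e = q j f" for i j e f
    by (simp only: ladder_eq_iff[OF LG] ladder_eq_iff[OF LH])
  define h where "h x = (case SOME ie. (case ie of (i, e) \<Rightarrow> p i e = x) of (i, e) \<Rightarrow> q i e)" for x
  have h: "h (p i e) = q i e" for i e
  proof -
    have "case (SOME ie. case ie of (j, f) \<Rightarrow> p j f = p i e) of (j, f) \<Rightarrow> p j f = p i e"
      by (rule someI[of _ "(i, e)"]) simp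
    then show ?thesis by (auto simp: h_def eq split: prod.splits)
  qed
  show ?thesis
  proof (rule graph_isoI[OF G H])
    show "bij_betw h (pverts G) (pverts H)"
      unfolding bij_betw_def
    proof
      show "inj_on h (pverts G)"
        by (intro inj_onI) (auto simp: ladder_verts[OF LG] h eq)
      show "h ` pverts G = pverts H"
        by (force simp: ladder_verts[OF LG] ladder_verts[OF LH] h)
    qed
    show "nbhd H (h x) = h ` nbhd G x" if "x \<in> pverts G" for x
      using that by (auto simp: ladder_verts[OF LG] ladder_nbhd[OF LG] ladder_nbhd[OF LH] h)
  qed
qed

lemma ladder_transfer:
  assumes iso: "graph_iso G H" and L: "ladder H n t q"
  obtains p where "ladder G n t p"
proof -
  obtain h where h: "bij_betw h (pverts G) (pverts H)"
    and sub: "\<And>x. x \<in> pverts G \<Longrightarrow> nbhd G x \<subseteq> pverts G"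
    and nb: "\<And>x. x \<in> pverts G \<Longrightarrow> nbhd H (h x) = h ` nbhd G x"
    using graph_isoE[OF iso] by blast
  define g where "g = inv_into (pverts G) h"
  have g: "bij_betw g (pverts H) (pverts G)" unfolding g_def by (rule bij_betw_inv_into[OF h])
  have hg: "h (g y) = y" if "y \<in> pverts H" for y
    using h that unfolding g_def by (simp add: bij_betw_inv_into_right)
  have "ladder G n t (\<lambda>i e. g (q i e))"
    unfolding ladder_def
  proof (intro conjI allI impI)
    show "pverts G = {g (q i e) | i e. True}"
      using bij_betw_imp_surj_on[OF g] unfolding ladder_verts[OF L] by blast
    fix i j e f
    have x: "g (q i e) \<in> pverts G" using bij_betwE[OF g] ladder_in_verts[OF L] by blast
    have "nbhd G (g (q i e)) = g ` h ` nbhd G (g (q i e))"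
      unfolding g_def using bij_betw_imp_inj_on[OF h] sub[OF x]
      by (simp add: inv_into_image_cancel g_def)
    also have "h ` nbhd G (g (q i e)) = nbhd H (q i e)"
      using nb[OF x] hg[OF ladder_in_verts[OF L]] by simp
    finally show "nbhd G (g (q i e)) = {g (q (i + 1) e), g (q (i - 1) e), g (q i (\<not> e))}"
      by (simp add: ladder_nbhd[OF L])
    show "g (q (i + int n) e) = g (q i (e \<noteq> t))" by (simp only: ladder_period[OF L])
    assume "g (q i e) = g (q j f)" and ij: "\<bar>i - j\<bar> < int n"
    then have "q i e = q j f" using hg[OF ladder_in_verts[OF L]] by metis
    then show "i = j" "e = f" using ladder_inj[OF L _ ij] by auto
  qed (rule ladder_pos[OF L])
  then show ?thesis by (rule that)
qed

lemma cycle_arc_iff: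
  assumes n: "n > 0" and y: "y < n"
  shows "y = Suc (nat (i mod int n)) mod n \<longleftrightarrow> y = nat ((i + 1) mod int n)"
    and "nat (i mod int n) = Suc y mod n \<longleftrightarrow> y = nat ((i - 1) mod int n)"
proof -
  have pos: "0 \<le> k mod int n" for k using n by simp
  have "int (Suc (nat (i mod int n)) mod n) = (i mod int n + 1) mod int n"
    using pos[of i] by (simp add: zmod_int add.commute)
  also have "\<dots> = (i + 1) mod int n" by (rule mod_add_left_eq)
  finally show "y = Suc (nat (i mod int n)) mod n \<longleftrightarrow> y = nat ((i + 1) mod int n)" by auto
  have "nat (i mod int n) = Suc y mod n \<longleftrightarrow> int (nat (i mod int n)) = int (Suc y mod n)"
    by (simp only: of_nat_eq_iff)
  also have "\<dots> \<longleftrightarrow> i mod int n = (int y + 1) mod int n"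
    using pos[of i] by (simp add: zmod_int add.commute)
  also have "\<dots> \<longleftrightarrow> (i - 1) mod int n = int y mod int n"
    by (auto simp: mod_eq_dvd_iff algebra_simps)
  also have "\<dots> \<longleftrightarrow> y = nat ((i - 1) mod int n)"
    using y pos[of "i - 1"] by auto
  finally show "nat (i mod int n) = Suc y mod n \<longleftrightarrow> y = nat ((i - 1) mod int n)" .
qed

lemma prism_wf: "pair_wf_digraph (box_product (cycle_graph n) (complete_graph m))"
  by unfold_locales (auto simp: box_product_def cycle_graph_def complete_graph_def)

lemma prism_ladder:
  assumes n: "n > 0"
  shows "ladder (box_product (cycle_graph n) (complete_graph 2)) n False
    (\<lambda>i e. (nat (i mod int n), if e then 1 else 0))"
  unfolding ladder_def
proof (intro conjI allI impI)
  have lt: "nat (k mod int n) < n" for k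
    using n pos_mod_bound[of "int n" k] pos_mod_sign[of "int n" k] by linarith
  have two: "b < 2 \<longleftrightarrow> b = 0 \<or> b = 1" for b :: nat by auto
  show "pverts (box_product (cycle_graph n) (complete_graph 2))
      = {(nat (i mod int n), if e then 1 else 0) | i e. True}"
  proof (intro equalityI subsetI)
    fix x assume "x \<in> pverts (box_product (cycle_graph n) (complete_graph 2))"
    then have "fst x < n" "snd x = 0 \<or> snd x = 1"
      by (auto simp: box_product_def cycle_graph_def complete_graph_def two)
    then have "x = (nat (int (fst x) mod int n), if snd x = 1 then 1 else 0)"
      by (auto simp: prod_eq_iff)
    then show "x \<in> {(nat (i mod int n), if e then 1 else 0) | i e. True}" by blast
  qed (auto simp: box_product_def cycle_graph_def complete_graph_def lt)
  fix i j :: int and e f :: bool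
  show "nbhd (box_product (cycle_graph n) (complete_graph 2)) (nat (i mod int n), if e then 1 else 0)
      = {(nat ((i + 1) mod int n), if e then 1 else 0), (nat ((i - 1) mod int n), if e then 1 else 0),
         (nat (i mod int n), if \<not> e then 1 else 0)}"
  proof (rule Set.set_eqI)
    fix z :: "nat \<times> nat"
    obtain y b where z: "z = (y, b)" by (cases z)
    have "z \<in> nbhd (box_product (cycle_graph n) (complete_graph 2)) (nat (i mod int n), if e then 1 else 0)
      \<longleftrightarrow> y = nat (i mod int n) \<and> b < 2 \<and> b \<noteq> (if e then 1 else 0)
        \<or> b = (if e then 1 else 0) \<and> y < n \<and> (y = Suc (nat (i mod int n)) mod n \<or> nat (i mod int n) = Suc y mod n)"
      using lt by (auto simp: z nbhd_def box_product_def cycle_graph_def complete_graph_def)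
    also have "\<dots> \<longleftrightarrow> y = nat (i mod int n) \<and> b = (if \<not> e then 1 else 0)
        \<or> b = (if e then 1 else 0) \<and> (y = nat ((i + 1) mod int n) \<or> y = nat ((i - 1) mod int n))"
      using cycle_arc_iff[OF n, of y i] lt unfolding two by auto
    finally show "z \<in> nbhd (box_product (cycle_graph n) (complete_graph 2)) (nat (i mod int n), if e then 1 else 0)
      \<longleftrightarrow> z \<in> {(nat ((i + 1) mod int n), if e then 1 else 0), (nat ((i - 1) mod int n), if e then 1 else 0),
         (nat (i mod int n), if \<not> e then 1 else 0)}"
      unfolding z by auto
  qed
  show "(nat ((i + int n) mod int n), if e then 1 else 0) = (nat (i mod int n), if e \<noteq> False then 1 else 0 :: nat)"
    by simp
  assume eq: "(nat (i mod int n), if e then 1 else 0 :: nat) = (nat (j mod int n), if f then 1 else 0)"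
    and ij: "\<bar>i - j\<bar> < int n"
  show "e = f" using eq by (auto split: if_splits)
  have "i mod int n = j mod int n" using eq n by (auto simp: nat_eq_iff)
  then have "int n dvd i - j" by (simp add: mod_eq_dvd_iff)
  then show "i = j" using ij dvd_imp_le_int[of "i - j" "int n"] by (cases "i = j") auto
qed (rule n)

lemma mobius_wf: "pair_wf_digraph (mobius_cayley k)"
  by unfold_locales (auto simp: mobius_cayley_def cayley_graph_def)

lemma mobius_nbhd:
  assumes k: "k > 0"
  shows "nbhd (mobius_cayley k) (x mod int (8 * k))
    = {(x + 1) mod int (8 * k), (x - 1) mod int (8 * k), (x + int (4 * k)) mod int (8 * k)}"
proof (rule Set.set_eqI)
  fix y
  let ?N = "int (8 * k)"
  have carr: "z \<in> carrier (integer_mod_group (8 * k)) \<longleftrightarrow> 0 \<le> z \<and> z < ?N" for z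
    using k by (simp add: carrier_integer_mod_group)
  have one: "(1::int) = 1 mod ?N" "int (4 * k) = int (4 * k) mod ?N" using k by auto
  have inv1: "inv\<^bsub>integer_mod_group (8 * k)\<^esub> 1 = (- 1) mod ?N"
    using k by (simp add: carr)
  have "y \<in> nbhd (mobius_cayley k) (x mod ?N) \<longleftrightarrow> 0 \<le> y \<and> y < ?N \<and>
      (x mod ?N + (- y) mod ?N) mod ?N \<in> {1, (- 1) mod ?N, int (4 * k)}"
    unfolding nbhd_def mobius_cayley_def cayley_graph_def inv1 using k
    by (auto simp: carr)
  also have "(x mod ?N + (- y) mod ?N) mod ?N = (x - y) mod ?N" by (simp add: mod_simps)
  also have "0 \<le> y \<and> y < ?N \<and> (x - y) mod ?N \<in> {1, (- 1) mod ?N, int (4 * k)}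
      \<longleftrightarrow> 0 \<le> y \<and> y < ?N \<and> ((x - y) mod ?N = 1 mod ?N \<or> (x - y) mod ?N = (- 1) mod ?N
        \<or> (x - y) mod ?N = int (4 * k) mod ?N)"
    using one by (simp add: mult.commute[of "int k" 4])
  also have "\<dots> \<longleftrightarrow> 0 \<le> y \<and> y < ?N \<and>
     (y mod ?N = (x - 1) mod ?N \<or> y mod ?N = (x + 1) mod ?N \<or> y mod ?N = (x + int (4 * k)) mod ?N)"
  proof -
    have "(x - y) mod ?N = 1 mod ?N \<longleftrightarrow> y mod ?N = (x - 1) mod ?N"
      unfolding mod_eq_dvd_iff by (subst dvd_minus_iff[symmetric]) (simp add: algebra_simps)
    moreover have "(x - y) mod ?N = (- 1) mod ?N \<longleftrightarrow> y mod ?N = (x + 1) mod ?N"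
      unfolding mod_eq_dvd_iff by (subst dvd_minus_iff[symmetric]) (simp add: algebra_simps)
    moreover have "(x - y) mod ?N = int (4 * k) mod ?N \<longleftrightarrow> y mod ?N = (x + int (4 * k)) mod ?N"
    proof -
      have "(x - y) mod ?N = int (4 * k) mod ?N \<longleftrightarrow> ?N dvd - (x - y - int (4 * k)) - ?N"
        unfolding mod_eq_dvd_iff by (metis dvd_diff_left_iff dvd_minus_iff dvd_refl)
      also have "- (x - y - int (4 * k)) - ?N = y - (x + int (4 * k))" by simp
      finally show ?thesis unfolding mod_eq_dvd_iff .
    qed
    ultimately show ?thesis by blast
  qed
  also have "\<dots> \<longleftrightarrow> y \<in> {(x + 1) mod ?N, (x - 1) mod ?N, (x + int (4 * k)) mod ?N}"
    using k by auto
  finally show "y \<in> nbhd (mobius_cayley k) (x mod ?N)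
      \<longleftrightarrow> y \<in> {(x + 1) mod ?N, (x - 1) mod ?N, (x + int (4 * k)) mod ?N}" .
qed

lemma mobius_ladder:
  assumes k: "k > 0"
  shows "ladder (mobius_cayley k) (4 * k) True
    (\<lambda>i e. (i + (if e then int (4 * k) else 0)) mod int (8 * k))"
  unfolding ladder_def
proof (intro conjI allI impI)
  show "4 * k > 0" using k by simp
  have V: "pverts (mobius_cayley k) = {0..<int (8 * k)}"
    using k by (simp add: mobius_cayley_def cayley_graph_def carrier_integer_mod_group)
  show "pverts (mobius_cayley k) = {(i + (if e then int (4 * k) else 0)) mod int (8 * k) | i e. True}"
    unfolding V
  proof (intro equalityI subsetI)
    fix x assume "x \<in> {0..<int (8 * k)}"
    then have "x = (x + (if False then int (4 * k) else 0)) mod int (8 * k)" by simp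
    then show "x \<in> {(i + (if e then int (4 * k) else 0)) mod int (8 * k) | i e. True}" by blast
  qed (use k in auto)
  fix i j :: int and e f :: bool
  have wrap: "(x + int (4 * k) + int (4 * k)) mod int (8 * k) = x mod int (8 * k)" for x
  proof -
    have "x + int (4 * k) + int (4 * k) = x + int (8 * k)" by simp
    then show ?thesis by (simp only: mod_add_self2)
  qed
  show "nbhd (mobius_cayley k) ((i + (if e then int (4 * k) else 0)) mod int (8 * k))
      = {(i + 1 + (if e then int (4 * k) else 0)) mod int (8 * k),
         (i - 1 + (if e then int (4 * k) else 0)) mod int (8 * k),
         (i + (if \<not> e then int (4 * k) else 0)) mod int (8 * k)}"
    unfolding mobius_nbhd[OF k] using wrap[of i] by (cases e) (simp_all add: algebra_simps)
  show "(i + int (4 * k) + (if e then int (4 * k) else 0)) mod int (8 * k)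
      = (i + (if e \<noteq> True then int (4 * k) else 0)) mod int (8 * k)"
    using wrap[of i] by (cases e) simp_all
  assume eq: "(i + (if e then int (4 * k) else 0)) mod int (8 * k)
      = (j + (if f then int (4 * k) else 0)) mod int (8 * k)"
    and ij: "\<bar>i - j\<bar> < int (4 * k)"
  define d where "d = (i + (if e then int (4 * k) else 0)) - (j + (if f then int (4 * k) else 0))"
  have "int (8 * k) dvd d" using eq by (simp add: mod_eq_dvd_iff d_def)
  moreover have "\<bar>d\<bar> < int (8 * k)" using ij by (auto simp: d_def)
  ultimately have "d = 0" using dvd_imp_le_int[of d "int (8 * k)"] by (cases "d = 0") auto
  then show "i = j" "e = f" using ij by (auto simp: d_def split: if_splits)
qed


section \<open>Cubic abelian Cayley graphs are closed ladders\<close>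

text \<open>
  A map from the infinite ladder that is compatible with steps in all directions is a quotient
  by translations that may exchange the sides. The number of rungs is the least positive
  translation that brings a column back to itself, and \<open>t\<close> records whether this
  translation exchanges the sides.
\<close>

lemma ladder_of_covering:
  assumes pg: "pair_graph G"
    and verts: "pverts G = {p i e | i e. True}"
    and nb: "\<And>i e. nbhd G (p i e) = {p (i + 1) e, p (i - 1) e, p i (\<not> e)}"
    and deck: "\<And>i j e f. p i e = p j f \<Longrightarrow>
      p (i + 1) e = p (j + 1) f \<and> p (i - 1) e = p (j - 1) f \<and> p i (\<not> e) = p j (\<not> f)"
    and ne: "p 0 True \<noteq> p 0 False"
  obtains n t where "ladder G n t p"
proof -
  have shift: "p (i + d) e = p (j + d) f" if "p i e = p j f" for i j e f d
  proof (induction d rule: int_induct[where k = 0])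
    case (step1 d)
    then show ?case using deck[of "i + d" e "j + d" f] by (simp add: algebra_simps)
  next
    case (step2 d)
    then show ?case using deck[of "i + d" e "j + d" f] by (simp add: algebra_simps)
  qed (use that in simp)
  let ?Q = "\<lambda>d. d > 0 \<and> (\<exists>f. p (int d) False = p 0 f)"
  \<comment> \<open>By finiteness some two columns coincide.\<close>
  have "\<exists>d. ?Q d"
  proof -
    have "finite (range (\<lambda>i. p i False))"
      using finite_pverts[OF pg] by (rule finite_subset[rotated]) (auto simp: verts)
    then have "\<not> inj (\<lambda>i :: int. p i False)"
      using finite_imageD infinite_UNIV_int by blast
    then obtain i j where "i < j" "p j False = p i False"
      unfolding inj_def by (metis linorder_neqE)
    then have "p (int (nat (j - i))) False = p 0 False" "nat (j - i) > 0"
      using shift[of j False i False "- i"] by auto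
    then show ?thesis by blast
  qed
  define n where "n = (LEAST d. ?Q d)"
  have n: "?Q n" unfolding n_def by (rule LeastI_ex) fact
  have minimal: "n \<le> d" if "?Q d" for d unfolding n_def using that by (rule Least_le)
  obtain t where t: "p (int n) False = p 0 t" using n by blast
  have inj0: "i = j \<and> e = f" if eq: "p i e = p j f" and ij: "j \<le> i" "i - j < int n" for i j e f
  proof -
    have e0: "p (i - j) e = p 0 f" using shift[OF eq, of "- j"] by simp
    have "\<exists>f'. p (i - j) False = p 0 f'"
    proof (cases e)
      case True
      then have "p (i - j) False = p 0 (\<not> f)" using deck[OF e0] by simp
      then show ?thesis by blast
    qed (use e0 in auto)
    then have "i = j" using minimal[of "nat (i - j)"] ij by (cases "i = j") auto
    then have "p 0 e = p 0 f" using e0 by simp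
    then show ?thesis using ne \<open>i = j\<close> by (cases e; cases f) auto
  qed
  have "ladder G n t p"
    unfolding ladder_def
  proof (intro conjI allI impI)
    show "n > 0" using n by simp
    fix i j e f
    have per: "p (i + int n) False = p i t"
      using shift[OF t, of i] by (simp add: algebra_simps)
    show "p (i + int n) e = p i (e \<noteq> t)"
      using per deck[OF per] by (cases e) auto
    assume eq: "p i e = p j f" and ij: "\<bar>i - j\<bar> < int n"
    have "i = j \<and> e = f"
      using inj0[OF eq] inj0[OF eq[symmetric]] ij by (cases "j \<le> i") auto
    then show "i = j" "e = f" by auto
  qed (use verts nb in auto)
  then show ?thesis by (rule that)
qed

text \<open>
  Inversion permutes three elements, so it fixes one of them, and then either swaps or fixes the
  other two.
\<close>

lemma cubic_connection_set:
  assumes A: "group A" and C: "C \<subseteq> carrier A" "C = m_inv A ` C" "card C = 3"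
  obtains a b c where "C = {a, b, c}" "distinct [a, b, c]" "inv\<^bsub>A\<^esub> b = b"
    "c = inv\<^bsub>A\<^esub> a \<or> inv\<^bsub>A\<^esub> a = a \<and> inv\<^bsub>A\<^esub> c = c"
proof -
  interpret group A by fact
  obtain x y z where xyz: "C = {x, y, z}" "x \<noteq> y" "x \<noteq> z" "y \<noteq> z"
    using C(3) by (auto simp: card_3_iff)
  have closed: "inv\<^bsub>A\<^esub> g \<in> {x, y, z}" if "g \<in> {x, y, z}" for g
    using C(2) that unfolding xyz by blast
  have inv: "inv\<^bsub>A\<^esub> (inv\<^bsub>A\<^esub> x) = x" "inv\<^bsub>A\<^esub> (inv\<^bsub>A\<^esub> y) = y" "inv\<^bsub>A\<^esub> (inv\<^bsub>A\<^esub> z) = z"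
    using C(1) xyz by auto
  consider "inv\<^bsub>A\<^esub> x = x" | "inv\<^bsub>A\<^esub> x = y" | "inv\<^bsub>A\<^esub> x = z" using closed[of x] by auto
  then show ?thesis
  proof cases
    case 1
    then have "inv\<^bsub>A\<^esub> y = y \<and> inv\<^bsub>A\<^esub> z = z \<or> inv\<^bsub>A\<^esub> y = z"
      using closed[of y] closed[of z] inv xyz by auto
    then show ?thesis using 1 xyz by (intro that[of y x z]) auto
  next
    case 2
    then have "inv\<^bsub>A\<^esub> z = z" using closed[of z] inv xyz by auto
    then show ?thesis using 2 xyz by (intro that[of x z y]) auto
  next
    case 3
    then have "inv\<^bsub>A\<^esub> y = y" using closed[of y] inv xyz by auto
    then show ?thesis using 3 xyz by (intro that[of x y z]) auto
  qed
qed

lemma cayley_nbhd: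
  assumes A: "comm_group A" and C: "C \<subseteq> carrier A" "C = m_inv A ` C" and x: "x \<in> carrier A"
  shows "nbhd (cayley_graph A C) x = (\<lambda>g. x \<otimes>\<^bsub>A\<^esub> g) ` C"
proof -
  interpret comm_group A by fact
  have inv_C: "inv\<^bsub>A\<^esub> g \<in> C" if "g \<in> C" for g using that C(2) by blast
  show ?thesis
  proof (intro equalityI subsetI)
    fix y assume "y \<in> nbhd (cayley_graph A C) x"
    then have y: "y \<in> carrier A" "x \<otimes>\<^bsub>A\<^esub> inv\<^bsub>A\<^esub> y \<in> C" by (auto simp: nbhd_def cayley_graph_def)
    have "inv\<^bsub>A\<^esub> (x \<otimes>\<^bsub>A\<^esub> inv\<^bsub>A\<^esub> y) = inv\<^bsub>A\<^esub> x \<otimes>\<^bsub>A\<^esub> y"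
      using x y(1) inv_mult[of x "inv\<^bsub>A\<^esub> y"] by simp
    moreover have "x \<otimes>\<^bsub>A\<^esub> (inv\<^bsub>A\<^esub> x \<otimes>\<^bsub>A\<^esub> y) = y" using x y(1) by (simp flip: m_assoc)
    ultimately show "y \<in> (\<lambda>g. x \<otimes>\<^bsub>A\<^esub> g) ` C" using inv_C[OF y(2)] by force
  next
    fix y assume "y \<in> (\<lambda>g. x \<otimes>\<^bsub>A\<^esub> g) ` C"
    then obtain g where g: "g \<in> C" "y = x \<otimes>\<^bsub>A\<^esub> g" by blast
    then have gA: "g \<in> carrier A" using C by blast
    have "x \<otimes>\<^bsub>A\<^esub> inv\<^bsub>A\<^esub> y = inv\<^bsub>A\<^esub> g"
      using x gA m_assoc[of x "inv\<^bsub>A\<^esub> x" "inv\<^bsub>A\<^esub> g"] by (simp add: g(2) inv_mult)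
    then show "y \<in> nbhd (cayley_graph A C) x"
      using x gA inv_C[OF g(1)] by (simp add: nbhd_def cayley_graph_def g(2))
  qed
qed

lemma connected_closed_under_nbhd:
  assumes conn: "Digraph_Component.connected (with_proj G)" and pg: "pair_graph G"
    and v: "v \<in> R" "v \<in> pverts G" and closed: "\<And>x. x \<in> R \<Longrightarrow> nbhd G x \<subseteq> R"
  shows "pverts G \<subseteq> R"
proof
  fix u assume "u \<in> pverts G"
  then have "(v, u) \<in> rtrancl_on (pverts G) ((parcs G)\<^sup>s)"
    using conn v(2) by (simp add: connected_conv)
  then show "u \<in> R"
  proof (induction rule: rtrancl_on_induct)
    case (step y z)
    then have "z \<in> nbhd G y" using nbhd_sym[OF pg] by (auto simp: symcl_def nbhd_def)
    then show ?case using closed step by blast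
  qed (rule v(1))
qed

text \<open>
  Take \<open>b\<close> as rung and step along the ladder alternately by \<open>a\<close> and
  \<open>c\<inverse>\<close>. If \<open>c = a\<inverse>\<close>, every step is \<open>a\<close>.
  If all three generators are involutions, the steps alternate, and the covering is still
  compatible with steps because an even column never meets an odd one. The latter case covers
  \<open>K\<^sub>4\<close> and the cube without separate treatment.
\<close>

lemma cubic_abelian_cayley_ladder:
  fixes G :: "'a pair_pre_digraph"
  assumes cay: "abelian_cayley_graph G"
    and conn: "Digraph_Component.connected (with_proj G)" and cub: "cubic G"
  obtains n t p where "ladder G n t p"
proof -
  note pg = abelian_cayley_pair_graph[OF cay]
  obtain A :: "'a monoid" and C where A: "comm_group A" and C: "C \<subseteq> carrier A - {\<one>\<^bsub>A\<^esub>}" "C = m_inv A ` C"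
    and G: "G = cayley_graph A C"
    using cay unfolding abelian_cayley_graph_def by blast
  interpret comm_group A by fact
  have CA: "C \<subseteq> carrier A" using C by blast
  have V: "pverts G = carrier A" by (simp add: G cayley_graph_def)
  note nb = cayley_nbhd[OF A CA C(2), folded G]
  have "nbhd G \<one>\<^bsub>A\<^esub> = C" using nb[of "\<one>\<^bsub>A\<^esub>"] CA by (force simp: subset_iff)
  then have "card C = 3" using cub V by (auto simp: cubic_def)
  then obtain a b c where abc: "C = {a, b, c}" "distinct [a, b, c]" and b: "inv\<^bsub>A\<^esub> b = b"
    and ac: "c = inv\<^bsub>A\<^esub> a \<or> inv\<^bsub>A\<^esub> a = a \<and> inv\<^bsub>A\<^esub> c = c"
    using cubic_connection_set[OF is_group CA C(2)] by metis
  have carr: "a \<in> carrier A" "b \<in> carrier A" "c \<in> carrier A" and ne1: "a \<noteq> \<one>\<^bsub>A\<^esub>" "b \<noteq> \<one>\<^bsub>A\<^esub>" "c \<noteq> \<one>\<^bsub>A\<^esub>"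
    using C(1) abc by auto
  have bb: "b \<otimes>\<^bsub>A\<^esub> b = \<one>\<^bsub>A\<^esub>" using r_inv[OF carr(2)] b by simp
  define d where "d = a \<otimes>\<^bsub>A\<^esub> inv\<^bsub>A\<^esub> c"
  have d: "d \<in> carrier A" using carr by (simp add: d_def)
  define q where "q i = d [^]\<^bsub>A\<^esub> (i div 2) \<otimes>\<^bsub>A\<^esub> (if odd i then a else \<one>\<^bsub>A\<^esub>)" for i :: int
  define \<beta> where "\<beta> e = (if e then b else \<one>\<^bsub>A\<^esub>)" for e
  define p where "p i e = q i \<otimes>\<^bsub>A\<^esub> \<beta> e" for i e
  have qA: "q i \<in> carrier A" and \<beta>A: "\<beta> e \<in> carrier A" for i e
    using carr d by (auto simp: q_def \<beta>_def)
  then have pA: "p i e \<in> carrier A" for i e by (simp add: p_def)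
  define fwd where "fwd i = (if even i then a else inv\<^bsub>A\<^esub> c)" for i :: int
  define bwd where "bwd i = (if even i then c else inv\<^bsub>A\<^esub> a)" for i :: int
  have fwdA: "fwd i \<in> carrier A" and bwdA: "bwd i \<in> carrier A" for i
    using carr by (auto simp: fwd_def bwd_def)
  have q_fwd: "q (i + 1) = q i \<otimes>\<^bsub>A\<^esub> fwd i" for i
  proof (cases "even i")
    case True
    then have "(i + 1) div 2 = i div 2" by presburger
    then show ?thesis using True d carr by (simp add: q_def fwd_def)
  next
    case False
    then have "(i + 1) div 2 = i div 2 + 1" by presburger
    then have "q (i + 1) = d [^]\<^bsub>A\<^esub> (i div 2) \<otimes>\<^bsub>A\<^esub> (a \<otimes>\<^bsub>A\<^esub> inv\<^bsub>A\<^esub> c)"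
      using False d by (simp add: q_def int_pow_mult d_def[symmetric])
    then show ?thesis using False d carr by (simp add: q_def fwd_def m_assoc)
  qed
  have fwd_bwd: "fwd (i - 1) \<otimes>\<^bsub>A\<^esub> bwd i = \<one>\<^bsub>A\<^esub>" for i
    using carr by (simp add: fwd_def bwd_def)
  have q_bwd: "q (i - 1) = q i \<otimes>\<^bsub>A\<^esub> bwd i" for i
  proof -
    have "q i \<otimes>\<^bsub>A\<^esub> bwd i = q (i - 1) \<otimes>\<^bsub>A\<^esub> (fwd (i - 1) \<otimes>\<^bsub>A\<^esub> bwd i)"
      using q_fwd[of "i - 1"] qA fwdA bwdA by (simp add: m_assoc)
    then show ?thesis using fwd_bwd qA by simp
  qed
  have p_fwd: "p (i + 1) e = p i e \<otimes>\<^bsub>A\<^esub> fwd i" and p_bwd: "p (i - 1) e = p i e \<otimes>\<^bsub>A\<^esub> bwd i" for i e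
    using qA[of i] \<beta>A[of e] fwdA[of i] bwdA[of i]
    by (simp_all add: p_def q_fwd q_bwd m_assoc m_comm[of "\<beta> e"])
  have p_flip: "p i (\<not> e) = p i e \<otimes>\<^bsub>A\<^esub> b" for i e
    using qA[of i] carr bb by (simp add: p_def \<beta>_def m_assoc)
  have nbhd: "nbhd G (p i e) = {p (i + 1) e, p (i - 1) e, p i (\<not> e)}" for i e
  proof -
    have "{fwd i, bwd i, b} = C"
      using ac abc carr by (auto simp: fwd_def bwd_def)
    then have "nbhd G (p i e) = (\<lambda>g. p i e \<otimes>\<^bsub>A\<^esub> g) ` {fwd i, bwd i, b}" using nb[OF pA] by simp
    then show ?thesis by (simp add: p_fwd p_bwd p_flip)
  qed
  \<comment> \<open>The products of an even number of steps form \<open>{1, d}\<close> with \<open>d = a c\<close>, up to the rung \<open>b\<close>;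
    an odd product would put \<open>a\<close> among \<open>1, d, b, d b\<close>.\<close>
  have odd_ne_even: "p i e \<noteq> p j f" if inv: "inv\<^bsub>A\<^esub> a = a" "inv\<^bsub>A\<^esub> c = c" and ij: "even i" "odd j" for i j e f
  proof
    assume eq: "p i e = p j f"
    have d_ac: "d = a \<otimes>\<^bsub>A\<^esub> c" by (simp add: d_def inv)
    have "inv\<^bsub>A\<^esub> d = d" using carr by (simp add: d_ac inv_mult inv)
    then have dd: "d \<otimes>\<^bsub>A\<^esub> d = \<one>\<^bsub>A\<^esub>" and d_inv: "inv\<^bsub>A\<^esub> d = d" using r_inv[OF d] by auto
    have pow: "d [^]\<^bsub>A\<^esub> k = \<one>\<^bsub>A\<^esub> \<or> d [^]\<^bsub>A\<^esub> k = d" for k :: int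
    proof (induction k rule: int_induct[where k = 0])
      case (step1 k)
      then show ?case using d dd by (auto simp: int_pow_mult)
    next
      case (step2 k)
      then show ?case using d dd d_inv by (auto simp: int_pow_diff)
    qed simp
    define x where "x = d [^]\<^bsub>A\<^esub> (i div 2)"
    define y where "y = d [^]\<^bsub>A\<^esub> (j div 2)"
    have xy: "x \<in> carrier A" "y \<in> carrier A" using d by (auto simp: x_def y_def)
    have "\<beta> f \<otimes>\<^bsub>A\<^esub> \<beta> f = \<one>\<^bsub>A\<^esub>" using bb by (simp add: \<beta>_def)
    moreover have "x \<otimes>\<^bsub>A\<^esub> \<beta> e = y \<otimes>\<^bsub>A\<^esub> (a \<otimes>\<^bsub>A\<^esub> \<beta> f)"
      using eq ij xy carr \<beta>A by (simp add: p_def q_def x_def y_def m_assoc)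
    then have "inv\<^bsub>A\<^esub> y \<otimes>\<^bsub>A\<^esub> (x \<otimes>\<^bsub>A\<^esub> \<beta> e) = a \<otimes>\<^bsub>A\<^esub> \<beta> f"
      using xy carr \<beta>A[of f] by (simp flip: m_assoc)
    ultimately have "inv\<^bsub>A\<^esub> y \<otimes>\<^bsub>A\<^esub> (x \<otimes>\<^bsub>A\<^esub> \<beta> e) \<otimes>\<^bsub>A\<^esub> \<beta> f = a"
      using carr \<beta>A[of f] by (simp add: m_assoc)
    moreover have "inv\<^bsub>A\<^esub> y \<otimes>\<^bsub>A\<^esub> x = x \<otimes>\<^bsub>A\<^esub> inv\<^bsub>A\<^esub> y" using xy by (simp add: m_comm)
    ultimately have "d [^]\<^bsub>A\<^esub> (i div 2 - j div 2) \<otimes>\<^bsub>A\<^esub> (\<beta> e \<otimes>\<^bsub>A\<^esub> \<beta> f) = a"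
      using xy \<beta>A[of e] \<beta>A[of f] d by (simp add: int_pow_diff x_def y_def flip: m_assoc)
    moreover have "\<beta> e \<otimes>\<^bsub>A\<^esub> \<beta> f = \<one>\<^bsub>A\<^esub> \<or> \<beta> e \<otimes>\<^bsub>A\<^esub> \<beta> f = b" using bb carr by (simp add: \<beta>_def)
    ultimately consider "\<one>\<^bsub>A\<^esub> = a" | "b = a" | "a \<otimes>\<^bsub>A\<^esub> c = a" | "a \<otimes>\<^bsub>A\<^esub> (c \<otimes>\<^bsub>A\<^esub> b) = a"
      using pow[of "i div 2 - j div 2"] carr d unfolding d_ac by (auto simp: m_assoc)
    then show False
    proof cases
      case 3
      then show False using carr ne1 by simp
    next
      case 4
      then have "c \<otimes>\<^bsub>A\<^esub> b = \<one>\<^bsub>A\<^esub>" using carr by simp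
      then have "inv\<^bsub>A\<^esub> b = c" using carr by (intro inv_equality)
      then show False using b abc by simp
    qed (use ne1 abc in auto)
  qed
  have same_step: "c = inv\<^bsub>A\<^esub> a \<or> even i = even j" if eq: "p i e = p j f" for i j e f
    using ac odd_ne_even[of i j e f] odd_ne_even[of j i f e] eq by (cases "even i"; cases "even j") auto
  have deck: "p (i + 1) e = p (j + 1) f \<and> p (i - 1) e = p (j - 1) f \<and> p i (\<not> e) = p j (\<not> f)"
    if eq: "p i e = p j f" for i j e f
  proof -
    have "fwd i = fwd j" "bwd i = bwd j"
      using same_step[OF eq] carr by (auto simp: fwd_def bwd_def)
    then show ?thesis by (simp add: p_fwd p_bwd p_flip eq)
  qed
  have verts: "pverts G = {p i e | i e. True}"
  proof
    show "pverts G \<subseteq> {p i e | i e. True}"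
    proof (rule connected_closed_under_nbhd[OF conn pg])
      show "p 0 False \<in> {p i e | i e. True}" by blast
      show "p 0 False \<in> pverts G" using pA V by simp
      show "nbhd G x \<subseteq> {p i e | i e. True}" if "x \<in> {p i e | i e. True}" for x
        using that nbhd by blast
    qed
  qed (use pA V in auto)
  have "p 0 True \<noteq> p 0 False" using carr ne1 by (simp add: p_def q_def \<beta>_def)
  then show ?thesis using ladder_of_covering[OF pg verts nbhd deck] that by metis
qed


section \<open>The eternal domination numbers\<close>

context
  fixes G :: "'a pair_pre_digraph" and n :: nat and t :: bool and p :: "int \<Rightarrow> bool \<Rightarrow> 'a"
  assumes L: "ladder G n t p" and pg: "pair_graph G"
begin

lemma eternal_weight_ge:
  assumes "eternally_fractionally_dominated G S"
  shows "real ((n + 1) div 2) \<le> S"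
proof -
  obtain w where "fractional_dominating G w" "w (p 0 False) \<ge> 1" "sum w (pverts G) \<le> S"
    using eternal_fractional_weight[OF pg assms ladder_in_verts[OF L]] .
  then show ?thesis using ladder_weight_ge[OF L pg _ ladder_in_verts[OF L]] by force
qed

lemma fractional_eternal_le:
  assumes "eternally_fractionally_dominated G S"
  shows "fractional_eternal_domination_number G \<le> S"
  unfolding fractional_eternal_domination_number_def
  using assms eternal_weight_ge by (intro cInf_lower bdd_belowI[where m = "real ((n + 1) div 2)"]) auto

lemma fractional_eternal_ge:
  assumes "eternally_fractionally_dominated G S"
  shows "real ((n + 1) div 2) \<le> fractional_eternal_domination_number G"
  unfolding fractional_eternal_domination_number_def
  using assms eternal_weight_ge by (intro cInf_greatest) auto

lemma frustrated_ge_3: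
  assumes "cubic G" "frustrated n t"
  shows "n \<ge> 3"
  using ladder_cubic[OF L assms(1)] assms(2) by (cases "n = 2") (auto simp: frustrated_def)

text \<open>
  The value is \<open>\<lceil>n/2\<rceil>\<close> for both numbers outside the frustrated case;
  inside it, \<open>n/2 + 3/4\<close> is below \<open>n/2 + 1\<close>.
\<close>

lemma fractional_less_iff_frustrated:
  assumes cay: "abelian_cayley_graph G" and cub: "cubic G"
  shows "fractional_eternal_domination_number G < real (domination_number G) \<longleftrightarrow> frustrated n t"
proof
  assume fr: "frustrated n t"
  have "fractional_eternal_domination_number G \<le> (2 * real n + 3) / 4"
    using fractional_eternal_le_focus[OF L pg cub frustrated_ge_3[OF cub fr]]
    by (rule fractional_eternal_le)
  moreover have "real (n div 2) = real n / 2"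
    using fr by (auto simp: frustrated_def real_of_nat_div)
  then have "real n / 2 + 1 \<le> real (domination_number G)"
    using domination_number_gt_if_frustrated[OF L pg cub fr] by linarith
  ultimately show "fractional_eternal_domination_number G < real (domination_number G)"
    by (simp add: field_simps)
next
  assume less: "fractional_eternal_domination_number G < real (domination_number G)"
  show "frustrated n t"
  proof (rule ccontr)
    assume "\<not> frustrated n t"
    then have "domination_number G \<le> (n + 1) div 2"
      by (rule domination_number_le_if_not_frustrated[OF L pg])
    then have "real (domination_number G) \<le> real ((n + 1) div 2)" by (rule of_nat_mono)
    then show False
      using fractional_eternal_ge[OF cayley_fractional_le_domination[OF cay]] less by linarith
  qed
qed

lemma frustrated_iso:
  assumes cub: "cubic G" and fr: "frustrated n t"
  shows "\<exists>k::nat. k \<ge> 1 \<and>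
    (graph_iso G (box_product (cycle_graph (4 * k + 2)) (complete_graph 2)) \<or>
     graph_iso G (mobius_cayley k))"
proof -
  have wf: "pair_wf_digraph G"
    using pg by (intro pair_fin_digraph.axioms(1) pair_digraph.axioms(1) pair_graph.axioms(1))
  have n: "n \<ge> 3" by (rule frustrated_ge_3[OF cub fr])
  show ?thesis
  proof (cases t)
    case True
    then obtain k where k: "n = 4 * k" using fr by (auto simp: frustrated_def)
    then have pos: "k > 0" using n by simp
    have "ladder G (4 * k) True p" using L True k by simp
    from ladder_iso[OF this wf mobius_ladder[OF pos] mobius_wf] show ?thesis
      using pos by (intro exI[of _ k]) auto
  next
    case False
    then have "even n" "\<not> 4 dvd n" using fr by (auto simp: frustrated_def)
    then have "n mod 4 = 2" by presburger
    moreover define k where "k = n div 4"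
    ultimately have k: "n = 4 * k + 2" using mult_div_mod_eq[of 4 n] by simp
    then have pos: "4 * k + 2 > 0" "k \<ge> 1" using n by auto
    have "ladder G (4 * k + 2) False p" using L False k by simp
    from ladder_iso[OF this wf prism_ladder[OF pos(1)] prism_wf] show ?thesis
      using pos(2) by (intro exI[of _ k]) auto
  qed
qed

end

theorem theorem5p6:
  fixes G :: "'a pair_pre_digraph"
  assumes "abelian_cayley_graph G"
    and "Digraph_Component.connected (with_proj G)"
    and "cubic G"
  shows "fractional_eternal_domination_number G \<le> real (domination_number G)
      \<and> domination_number G = m_eternal_domination_number G
      \<and> (fractional_eternal_domination_number G < real (domination_number G) \<longleftrightarrow>
           (\<exists>k::nat. k \<ge> 1 \<and>
              (graph_iso G (box_product (cycle_graph (4 * k + 2)) (complete_graph 2)) \<or>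
               graph_iso G (mobius_cayley k))))"
proof (intro conjI)
  note pg = abelian_cayley_pair_graph[OF assms(1)]
  obtain n t p where L: "ladder G n t p"
    using cubic_abelian_cayley_ladder[OF assms] .
  show "fractional_eternal_domination_number G \<le> real (domination_number G)"
    using fractional_eternal_le[OF L pg cayley_fractional_le_domination[OF assms(1)]] .
  show "domination_number G = m_eternal_domination_number G"
    by (rule cayley_m_eternal_eq_domination[OF assms(1)])
  show "fractional_eternal_domination_number G < real (domination_number G) \<longleftrightarrow>
           (\<exists>k::nat. k \<ge> 1 \<and>
              (graph_iso G (box_product (cycle_graph (4 * k + 2)) (complete_graph 2)) \<or>
               graph_iso G (mobius_cayley k)))" (is "?less \<longleftrightarrow> ?family")
  proof
    assume ?less
    then show ?family
      using fractional_less_iff_frustrated[OF L pg assms(1,3)] frustrated_iso[OF L pg assms(3)] by blast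
  next
    assume ?family
    then obtain k where k: "k \<ge> 1" and iso:
      "graph_iso G (box_product (cycle_graph (4 * k + 2)) (complete_graph 2)) \<or> graph_iso G (mobius_cayley k)"
      by blast
    have "\<exists>n t p. ladder G n t p \<and> frustrated n t"
      using iso
    proof
      assume "graph_iso G (box_product (cycle_graph (4 * k + 2)) (complete_graph 2))"
      then obtain p where "ladder G (4 * k + 2) False p"
        by (rule ladder_transfer[OF _ prism_ladder]) simp
      moreover have "frustrated (4 * k + 2) False" unfolding frustrated_def by presburger
      ultimately show ?thesis by blast
    next
      assume "graph_iso G (mobius_cayley k)"
      then obtain p where "ladder G (4 * k) True p"
        by (rule ladder_transfer[OF _ mobius_ladder]) (use k in simp)
      moreover have "frustrated (4 * k) True" by (simp add: frustrated_def)
      ultimately show ?thesis by blast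
    qed
    then show ?less using fractional_less_iff_frustrated[OF _ pg assms(1,3)] by blast
  qed
qed

end
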